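(* Let $A=(A_1,\dots,A_n)$ be an irreducible $n$-tuple of $d\times d$ complex matrices with $\|A\|<1$. The ideal $\mathfrak J=\ker\Phi_A$ of $\mathfrak L_n$ determines its range space $\mathcal M=\overline{\mathfrak J\mathcal K_n}$, which has wandering dimension $\dim\bigl(\mathcal M\ominus\sum_{i=1}^nL_i\mathcal M\bigr)=1+(n-1)d^2$. Thus there are $1+(n-1)d^2$ isometries $X_j$ in $\mathfrak L_n$ so that an $n$-tuple $B$ of $d\times d$ matrices with $\|B\|<1$ is similar to $A$ if and only if $\Phi_B(X_j)=0$ for $1\le j\le1+(n-1)d^2$. Moreover there is a set of $m=1+(n-1)d^2$ polynomials $p_j$ in $n$ non-commuting variables such that an $n$-tuple $B$ of $d\times d$ matrices with $\|B\|<1$ is similar to $A$ if and only if $p_j(B)=0$ for $1\le j\le m$.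
   Context: Fix integers $n\ge2$ and $d\ge1$. For an $n$-tuple $A$ of operators, $\|A\|$ is the norm of the row operator $[A_1\ \cdots\ A_n]$, i.e. $\|A\|^2=\|\sum_iA_iA_i^*\|$. $A$ is irreducible if the unital algebra generated by $A_1,\dots,A_n$ is all of $\mathfrak M_d$ (equivalently, has no proper nonzero invariant subspace). $A$ and $B$ are similar if there is one invertible $T$ with $B_i=TA_iT^{-1}$ for all $i$. $\mathcal F_n$ is the unital free semigroup on letters $1,\dots,n$; $\mathcal K_n=\ell^2(\mathcal F_n)$ with orthonormal basis $\{\xi_w\}$; $L_i\xi_w=\xi_{iw}$; $\mathfrak L_n$ is the unital algebra generated by $L_1,\dots,L_n$ closed in the weak operator topology (WOT). Each $n$-tuple $A$ of $d\times d$ matrices with $\|A\|<1$ determines a unique WOT-continuous unital homomorphism $\Phi_A:\mathfrak L_n\to\mathfrak M_d$ with $\Phi_A(L_i)=A_i$; explicitly, the minimal isometric dilation of $A$ (isometries $S_i$ with pairwise orthogonal ranges on a space containing $\mathcal V=\mathbb C^d$, with $S_i^*|_{\mathcal V}=A_i^*$ and generated by $\mathcal V$) is unitarily equivalent to $L^{(s)}=(L_1^{(s)},\dots,L_n^{(s)})$ (direct sum of $s$ copies) for some $s$, and $\Phi_A(X)=P_{\mathcal V}X^{(s)}|_{\mathcal V}$. *)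

theory Defs
  imports "HOL-Analysis.Analysis" "HOL-Library.Poly_Mapping"
begin

section \<open>The Hilbert space of square-summable complex families\<close>

typedef 'a ell2 = "{f :: 'a \<Rightarrow> complex. (\<lambda>x. (cmod (f x))\<^sup>2) summable_on UNIV}"
  by (rule exI[of _ "\<lambda>_. 0"]) simp

setup_lifting type_definition_ell2

lemma ell2_add_summable:
  fixes f g :: "'a \<Rightarrow> complex"
  assumes "(\<lambda>x. (cmod (f x))\<^sup>2) summable_on UNIV" "(\<lambda>x. (cmod (g x))\<^sup>2) summable_on UNIV"
  shows "(\<lambda>x. (cmod (f x + g x))\<^sup>2) summable_on UNIV"
proof (rule summable_on_comparison_test)
  show "(\<lambda>x. 2 * (cmod (f x))\<^sup>2 + 2 * (cmod (g x))\<^sup>2) summable_on UNIV"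
    using assms by (intro summable_on_add summable_on_cmult_right)
  fix x
  have "(cmod (f x + g x))\<^sup>2 \<le> (cmod (f x) + cmod (g x))\<^sup>2"
    by (simp add: norm_triangle_ineq power_mono)
  also have "\<dots> \<le> 2 * (cmod (f x))\<^sup>2 + 2 * (cmod (g x))\<^sup>2"
    using sum_squares_bound[of "cmod (f x)" "cmod (g x)"] by (simp add: power2_sum)
  finally show "(cmod (f x + g x))\<^sup>2 \<le> 2 * (cmod (f x))\<^sup>2 + 2 * (cmod (g x))\<^sup>2" .
qed simp

lemma ell2_scale_summable:
  fixes f :: "'a \<Rightarrow> complex"
  assumes "(\<lambda>x. (cmod (f x))\<^sup>2) summable_on UNIV"
  shows "(\<lambda>x. (cmod (c * f x))\<^sup>2) summable_on UNIV"
  using summable_on_cmult_right[OF assms] by (simp add: norm_mult power_mult_distrib)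

lemma ell2_mult_summable:
  fixes f g :: "'a \<Rightarrow> complex"
  assumes "(\<lambda>x. (cmod (f x))\<^sup>2) summable_on UNIV" "(\<lambda>x. (cmod (g x))\<^sup>2) summable_on UNIV"
  shows "(\<lambda>x. f x * cnj (g x)) summable_on UNIV"
proof (rule abs_summable_summable, rule summable_on_comparison_test)
  show "(\<lambda>x. (cmod (f x))\<^sup>2 + (cmod (g x))\<^sup>2) summable_on UNIV"
    using assms by (rule summable_on_add)
  fix x
  have "2 * (cmod (f x) * cmod (g x)) \<le> (cmod (f x))\<^sup>2 + (cmod (g x))\<^sup>2"
    using sum_squares_bound[of "cmod (f x)" "cmod (g x)"] by (simp add: mult.assoc)
  moreover have "0 \<le> cmod (f x) * cmod (g x)" by simp
  ultimately show "cmod (f x * cnj (g x)) \<le> (cmod (f x))\<^sup>2 + (cmod (g x))\<^sup>2"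
    unfolding norm_mult complex_mod_cnj by linarith
qed simp

lift_definition scale_ell2 :: "complex \<Rightarrow> 'a ell2 \<Rightarrow> 'a ell2" is "\<lambda>c f x. c * f x"
  by (rule ell2_scale_summable)

text \<open>The inner product is linear in the first argument.\<close>

lift_definition cinner_ell2 :: "'a ell2 \<Rightarrow> 'a ell2 \<Rightarrow> complex" is
  "\<lambda>f g. \<Sum>\<^sub>\<infinity>x. f x * cnj (g x)" .

instantiation ell2 :: (type) real_vector
begin

lift_definition zero_ell2 :: "'a ell2" is "\<lambda>_. 0" by simp
lift_definition plus_ell2 :: "'a ell2 \<Rightarrow> 'a ell2 \<Rightarrow> 'a ell2" is "\<lambda>f g x. f x + g x"
  by (rule ell2_add_summable)
lift_definition uminus_ell2 :: "'a ell2 \<Rightarrow> 'a ell2" is "\<lambda>f x. - f x" by simp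
lift_definition minus_ell2 :: "'a ell2 \<Rightarrow> 'a ell2 \<Rightarrow> 'a ell2" is "\<lambda>f g x. f x - g x"
  using ell2_add_summable[of _ "\<lambda>x. - _ x"] by simp
definition scaleR_ell2 :: "real \<Rightarrow> 'a ell2 \<Rightarrow> 'a ell2" where
  "scaleR_ell2 r = scale_ell2 (complex_of_real r)"

instance
  by intro_classes (unfold scaleR_ell2_def, (transfer, simp add: fun_eq_iff algebra_simps)+)

end

lemma cinner_ell2_add_left: "cinner_ell2 (x + y) z = cinner_ell2 x z + cinner_ell2 y z"
  by transfer (simp add: distrib_right infsum_add ell2_mult_summable)

lemma cinner_ell2_scale_left: "cinner_ell2 (scale_ell2 c x) y = c * cinner_ell2 x y"
  by transfer (simp add: mult.assoc infsum_cmult_right')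

lemma cinner_ell2_commute: "cinner_ell2 x y = cnj (cinner_ell2 y x)"
  by transfer (simp add: mult.commute flip: infsum_cnj)

lemma Re_cinner_ell2_self: "Re (cinner_ell2 x x) = (\<Sum>\<^sub>\<infinity>i. (cmod (Rep_ell2 x i))\<^sup>2)"
proof transfer
  fix f :: "'a \<Rightarrow> complex"
  assume "(\<lambda>x. (cmod (f x))\<^sup>2) summable_on UNIV"
  then have "(\<lambda>x. f x * cnj (f x)) summable_on UNIV"
    using ell2_mult_summable by blast
  then show "Re (\<Sum>\<^sub>\<infinity>x. f x * cnj (f x)) = (\<Sum>\<^sub>\<infinity>x. (cmod (f x))\<^sup>2)"
    by (simp add: cmod_power2 flip: infsum_Re) (simp add: power2_eq_square)
qed

instantiation ell2 :: (type) real_inner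
begin

definition inner_ell2 :: "'a ell2 \<Rightarrow> 'a ell2 \<Rightarrow> real" where
  "inner_ell2 x y = Re (cinner_ell2 x y)"
definition norm_ell2 :: "'a ell2 \<Rightarrow> real" where
  "norm_ell2 x = sqrt (inner x x)"
definition sgn_ell2 :: "'a ell2 \<Rightarrow> 'a ell2" where
  "sgn_ell2 x = x /\<^sub>R norm x"
definition dist_ell2 :: "'a ell2 \<Rightarrow> 'a ell2 \<Rightarrow> real" where
  "dist_ell2 x y = norm (x - y)"
definition uniformity_ell2 :: "('a ell2 \<times> 'a ell2) filter" where
  "uniformity_ell2 = (INF e\<in>{0<..}. principal {(x, y). dist x y < e})"
definition open_ell2 :: "'a ell2 set \<Rightarrow> bool" where
  "open_ell2 U \<longleftrightarrow> (\<forall>x\<in>U. \<forall>\<^sub>F (x', y) in uniformity. x' = x \<longrightarrow> y \<in> U)"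

instance
proof
  fix x y z :: "'a ell2" and r :: real
  show "inner x y = inner y x"
    unfolding inner_ell2_def by (subst cinner_ell2_commute) simp
  show "inner (x + y) z = inner x z + inner y z"
    by (simp add: inner_ell2_def cinner_ell2_add_left)
  show "inner (r *\<^sub>R x) y = r * inner x y"
    by (simp add: inner_ell2_def scaleR_ell2_def cinner_ell2_scale_left)
  show "0 \<le> inner x x"
    unfolding inner_ell2_def Re_cinner_ell2_self by (rule infsum_nonneg) simp
  show "inner x x = 0 \<longleftrightarrow> x = 0"
  proof
    assume "inner x x = 0"
    then have *: "(\<Sum>\<^sub>\<infinity>i. (cmod (Rep_ell2 x i))\<^sup>2) = 0"
      by (simp add: inner_ell2_def Re_cinner_ell2_self)
    have "(\<lambda>i. (cmod (Rep_ell2 x i))\<^sup>2) summable_on UNIV"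
      using Rep_ell2[of x] by simp
    then have "(cmod (Rep_ell2 x i))\<^sup>2 = 0" for i
      using nonneg_infsum_le_0D[of "\<lambda>i. (cmod (Rep_ell2 x i))\<^sup>2" UNIV i] * by simp
    then show "x = 0"
      by (simp add: Rep_ell2_inject[symmetric] zero_ell2.rep_eq fun_eq_iff)
  next
    assume "x = 0"
    then show "inner x x = 0"
      by (simp add: inner_ell2_def Re_cinner_ell2_self zero_ell2.rep_eq)
  qed
qed (simp_all add: norm_ell2_def sgn_ell2_def dist_ell2_def uniformity_ell2_def open_ell2_def)

end

global_interpretation ell2: vector_space "scale_ell2 :: complex \<Rightarrow> 'a ell2 \<Rightarrow> 'a ell2"
  by unfold_locales (transfer, simp add: fun_eq_iff algebra_simps)+

lift_definition basis_ell2 :: "'a \<Rightarrow> 'a ell2" is "\<lambda>a x. if x = a then 1 else 0"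
proof -
  fix a :: 'a
  have "(\<lambda>x. (cmod (if x = a then 1 else 0))\<^sup>2) summable_on {a}" by simp
  then show "(\<lambda>x. (cmod (if x = a then 1 else 0))\<^sup>2) summable_on UNIV"
    by (rule summable_on_cong_neutral[THEN iffD1, rotated -1]) auto
qed

type_synonym 'a operator = "'a ell2 \<Rightarrow> 'a ell2"

definition bounded_operators :: "'a operator set" where
  "bounded_operators =
     {T. bounded_linear T \<and> (\<forall>c x. T (scale_ell2 c x) = scale_ell2 c (T x))}"

text \<open>The weak operator topology: the coarsest topology on the bounded operators for which all
  functionals \<open>T \<mapsto> \<langle>T x, y\<rangle>\<close> are continuous (\<open>euclidean\<close> is here the product topology on the
  function space).\<close>

definition wot :: "'a operator topology" where
  "wot = pullback_topology bounded_operators (\<lambda>T (x, y). cinner_ell2 (T x) y) euclidean"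


section \<open>The free semigroup algebra\<close>

text \<open>The unital complex algebra generated by \<open>G\<close>, for explicitly given algebra operations.\<close>

inductive_set generated_algebra ::
  "'b \<Rightarrow> ('b \<Rightarrow> 'b \<Rightarrow> 'b) \<Rightarrow> ('b \<Rightarrow> 'b \<Rightarrow> 'b) \<Rightarrow> (complex \<Rightarrow> 'b \<Rightarrow> 'b) \<Rightarrow> 'b set \<Rightarrow> 'b set"
  for one :: 'b and add mult :: "'b \<Rightarrow> 'b \<Rightarrow> 'b" and scale :: "complex \<Rightarrow> 'b \<Rightarrow> 'b" and G :: "'b set"
where
  generator: "x \<in> G \<Longrightarrow> x \<in> generated_algebra one add mult scale G"
| one: "one \<in> generated_algebra one add mult scale G"
| add: "\<lbrakk>x \<in> generated_algebra one add mult scale G; y \<in> generated_algebra one add mult scale G\<rbrakk>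
    \<Longrightarrow> add x y \<in> generated_algebra one add mult scale G"
| mult: "\<lbrakk>x \<in> generated_algebra one add mult scale G; y \<in> generated_algebra one add mult scale G\<rbrakk>
    \<Longrightarrow> mult x y \<in> generated_algebra one add mult scale G"
| scale: "x \<in> generated_algebra one add mult scale G
    \<Longrightarrow> scale c x \<in> generated_algebra one add mult scale G"

definition op_add :: "'a operator \<Rightarrow> 'a operator \<Rightarrow> 'a operator" where
  "op_add S T = (\<lambda>x. S x + T x)"

definition op_scale :: "complex \<Rightarrow> 'a operator \<Rightarrow> 'a operator" where
  "op_scale c T = (\<lambda>x. scale_ell2 c (T x))"

text \<open>The free semigroup on \<open>'n\<close> is \<open>'n list\<close>, with the empty list as unit and append as product.\<close>

lift_definition left_creation :: "'n \<Rightarrow> 'n list operator" is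
  "\<lambda>i f w. case w of [] \<Rightarrow> 0 | j # v \<Rightarrow> if j = i then f v else 0"
proof -
  fix i :: 'n and f :: "'n list \<Rightarrow> complex"
  let ?g = "\<lambda>w. (cmod (case w of [] \<Rightarrow> 0 | j # v \<Rightarrow> if j = i then f v else 0))\<^sup>2"
  assume "(\<lambda>w. (cmod (f w))\<^sup>2) summable_on UNIV"
  then have "(?g \<circ> (#) i) summable_on UNIV" by (simp add: o_def)
  then have "?g summable_on range ((#) i)"
    by (subst summable_on_reindex) auto
  then show "?g summable_on UNIV"
    by (rule summable_on_cong_neutral[THEN iffD1, rotated -1]) (auto split: list.splits)
qed

lemma left_creation_basis: "left_creation i (basis_ell2 w) = basis_ell2 (i # w)"
  by transfer (auto simp: fun_eq_iff split: list.splits)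

definition free_semigroup_algebra :: "'n list operator set" where
  "free_semigroup_algebra =
     wot closure_of generated_algebra id op_add (\<circ>) op_scale (range left_creation)"


section \<open>Tuples of matrices\<close>

type_synonym ('n, 'd) tuple = "'n \<Rightarrow> complex ^ 'd ^ 'd"

definition mat_scale :: "complex \<Rightarrow> complex ^ 'd ^ 'd \<Rightarrow> complex ^ 'd ^ 'd" where
  "mat_scale c M = map_matrix ((*) c) M"

text \<open>The operator norm of the row operator \<open>[A\<^sub>1 \<dots> A\<^sub>n]\<close> from the direct sum of \<open>n\<close> copies of the
  Hilbert space \<open>complex ^ 'd\<close> to \<open>complex ^ 'd\<close>.\<close>

definition row_norm :: "('n::finite, 'd::finite) tuple \<Rightarrow> real" where
  "row_norm A = onorm (\<lambda>v :: complex ^ 'd ^ 'n. \<Sum>i\<in>UNIV. A i *v (v $ i))"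

definition irreducible_tuple :: "('n::finite, 'd::finite) tuple \<Rightarrow> bool" where
  "irreducible_tuple A \<longleftrightarrow> generated_algebra (mat 1) (+) (**) mat_scale (range A) = UNIV"

definition similar_tuples :: "('n::finite, 'd::finite) tuple \<Rightarrow> ('n, 'd) tuple \<Rightarrow> bool" where
  "similar_tuples A B \<longleftrightarrow> (\<exists>T. invertible T \<and> (\<forall>i. B i = T ** A i ** matrix_inv T))"

definition is_wot_representation ::
  "('n::finite, 'd::finite) tuple \<Rightarrow> ('n list operator \<Rightarrow> complex ^ 'd ^ 'd) \<Rightarrow> bool" where
  "is_wot_representation A \<Phi> \<longleftrightarrow>
     continuous_map (subtopology wot free_semigroup_algebra) euclidean \<Phi> \<and>
     \<Phi> id = mat 1 \<and>
     (\<forall>X\<in>free_semigroup_algebra. \<forall>Y\<in>free_semigroup_algebra.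
        \<Phi> (op_add X Y) = \<Phi> X + \<Phi> Y \<and> \<Phi> (X \<circ> Y) = \<Phi> X ** \<Phi> Y) \<and>
     (\<forall>c. \<forall>X\<in>free_semigroup_algebra. \<Phi> (op_scale c X) = mat_scale c (\<Phi> X)) \<and>
     (\<forall>i. \<Phi> (left_creation i) = A i)"

text \<open>For \<open>row_norm A < 1\<close> there is exactly one such homomorphism; \<open>extensional\<close> fixes the
  irrelevant values off the algebra, so that the description is unique as a HOL function.\<close>

definition Phi :: "('n::finite, 'd::finite) tuple \<Rightarrow> 'n list operator \<Rightarrow> complex ^ 'd ^ 'd" where
  "Phi A = (THE \<Phi>. \<Phi> \<in> extensional free_semigroup_algebra \<and> is_wot_representation A \<Phi>)"

definition ker_Phi :: "('n::finite, 'd::finite) tuple \<Rightarrow> 'n list operator set" where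
  "ker_Phi A = {X \<in> free_semigroup_algebra. Phi A X = 0}"

definition range_space :: "'a operator set \<Rightarrow> 'a ell2 set" where
  "range_space J = closure (ell2.span {X x | X x. X \<in> J})"

definition wandering_space :: "'n::finite list ell2 set \<Rightarrow> 'n list ell2 set" where
  "wandering_space M =
     {x \<in> M. \<forall>y. (\<forall>i. y i \<in> M) \<longrightarrow> cinner_ell2 x (\<Sum>i\<in>UNIV. left_creation i (y i)) = 0}"

definition isometry :: "'a operator \<Rightarrow> bool" where
  "isometry X \<longleftrightarrow> (\<forall>x. norm (X x) = norm x)"

text \<open>A polynomial in non-commuting variables indexed by \<open>'n\<close> is a finitely supported family of
  complex coefficients indexed by words.\<close>

type_synonym 'n nc_poly = "'n list \<Rightarrow>\<^sub>0 complex"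

definition eval_word :: "('n::finite, 'd::finite) tuple \<Rightarrow> 'n list \<Rightarrow> complex ^ 'd ^ 'd" where
  "eval_word B w = foldr (\<lambda>i M. B i ** M) w (mat 1)"

definition eval_nc_poly :: "'n::finite nc_poly \<Rightarrow> ('n, 'd::finite) tuple \<Rightarrow> complex ^ 'd ^ 'd" where
  "eval_nc_poly p B =
     (\<Sum>w\<in>Poly_Mapping.keys p. mat_scale (Poly_Mapping.lookup p w) (eval_word B w))"

end

theory Submission
  imports Defs
begin

text \<open>
  Write \<open>\<xi>\<close> for the basis vector of the empty word and \<open>\<phi>\<^sub>A x = \<Sum>\<^sub>w x\<^sub>w A\<^sub>w\<close>, a bounded map on
  \<open>\<ell>\<^sup>2\<close> because \<open>\<Sum>\<^sub>w \<parallel>A\<^sub>w\<parallel>\<^sup>2\<close> converges. Then \<open>\<Phi>\<^sub>A X = \<phi>\<^sub>A (X \<xi>)\<close>, so no dilation theory is needed, and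
  the range space is \<open>M = ker \<phi>\<^sub>A\<close>, of codimension \<open>d\<^sup>2\<close>. The complement of \<open>\<Sum>\<^sub>i L\<^sub>i M\<close> is spanned by \<open>\<xi>\<close> and the
  spaces \<open>L\<^sub>i M\<^sup>\<bottom>\<close>, hence has dimension \<open>1 + n d\<^sup>2\<close>, and it contains \<open>M\<^sup>\<bottom>\<close>; removing the latter leaves
  the wandering space.

  A unit vector wandering for the right creation operators is the first column of an isometry
  commuting with them, and Fejer averaging puts such operators into the algebra. If \<open>\<Phi>\<^sub>B\<close>
  kills these isometries, the Wold decomposition gives \<open>ker \<phi>\<^sub>A \<subseteq> ker \<phi>\<^sub>B\<close>, so \<open>A\<^sub>w \<mapsto> B\<^sub>w\<close> is an
  endomorphism of the matrix algebra, which is inner by Skolem-Noether.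

  For the polynomials, take a prefix-closed set \<open>S\<close> of \<open>d\<^sup>2\<close> words with \<open>(A\<^sub>w)\<^bsub>w \<in> S\<^esub>\<close> a basis. Each of the
  \<open>n d\<^sup>2 - (d\<^sup>2 - 1)\<close> words \<open>wi\<close> leaving \<open>S\<close> gives one polynomial, and these generate the ideal of
  relations as a right ideal.
\<close>

section \<open>Hilbert space preliminaries\<close>

text \<open>Every operator of the algebra commutes with the right creation operators
  \<open>R_i\<close>, so it is convolution by \<open>X \<xi>\<close>; conversely, a bounded
  convolution is recovered from polynomials by Fejer means. Since
  \<open>X \<xi>_w = R_w X \<xi>\<close>, such an \<open>X\<close> is isometric exactly when the
  vectors \<open>R_w X \<xi>\<close> are orthonormal, which is why vectors wandering for the
  \<open>R_i\<close>, not for the \<open>L_i\<close>, produce isometries. Words multiply on either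
  side, so \<open>M\<close> is invariant under left and right creation alike, and one dimension
  count serves both families. The Wold argument settles the kernel inclusion because its remainder
  moves to ever longer words without growth of norm, while the tails of the vectors representing
  \<phi>_B tend to 0; this is where the norm bound on \<open>B\<close> enters. Right ideal
  generators suffice for the polynomials: the linear map sending the basis \<open>A_v\<close> to
  \<open>B_v\<close> respects right multiplication by letters, and this already forces
  multiplicativity. Both counts are instances of Schreier's index formula, with \<open>d^2\<close>
  as the index.\<close>

lemma ell2_eqI: "(\<And>w. Rep_ell2 x w = Rep_ell2 y w) \<Longrightarrow> x = y"
  by (metis Rep_ell2_inject ext)

lemmas Rep_ell2_simps [simp] =
  zero_ell2.rep_eq plus_ell2.rep_eq minus_ell2.rep_eq uminus_ell2.rep_eq scale_ell2.rep_eq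
  basis_ell2.rep_eq

lemma Rep_ell2_summable [simp]: "(\<lambda>w. (cmod (Rep_ell2 x w))\<^sup>2) summable_on UNIV"
  using Rep_ell2[of x] by simp

lemma Rep_ell2_sum [simp]: "Rep_ell2 (\<Sum>i\<in>I. f i) w = (\<Sum>i\<in>I. Rep_ell2 (f i) w)"
  by (induction I rule: infinite_finite_induct) auto

lemma norm_ell2_power2: "(norm x)\<^sup>2 = (\<Sum>\<^sub>\<infinity>w. (cmod (Rep_ell2 x w))\<^sup>2)"
  unfolding power2_norm_eq_inner inner_ell2_def Re_cinner_ell2_self ..

lemma ell2_membership_bounded:
  fixes f :: "'a \<Rightarrow> complex"
  assumes "\<And>F. finite F \<Longrightarrow> (\<Sum>w\<in>F. (cmod (f w))\<^sup>2) \<le> C"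
  shows "(\<lambda>w. (cmod (f w))\<^sup>2) summable_on UNIV"
  by (rule nonneg_bdd_above_summable_on) (auto intro!: bdd_aboveI2 assms)

lemma norm_ell2_power2_le:
  assumes "\<And>F. finite F \<Longrightarrow> (\<Sum>w\<in>F. (cmod (Rep_ell2 x w))\<^sup>2) \<le> C"
  shows "(norm x)\<^sup>2 \<le> C"
  unfolding norm_ell2_power2 by (rule infsum_le_finite_sums) (use assms in auto)

lemma sum_Rep_ell2_le_norm:
  assumes "finite F" shows "(\<Sum>w\<in>F. (cmod (Rep_ell2 x w))\<^sup>2) \<le> (norm x)\<^sup>2"
  unfolding norm_ell2_power2 by (rule finite_sum_le_infsum) (use assms in auto)

lemma cinner_ell2_add_right: "cinner_ell2 x (y + z) = cinner_ell2 x y + cinner_ell2 x z"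
  by (metis cinner_ell2_add_left cinner_ell2_commute complex_cnj_add)

lemma cinner_ell2_scale_right: "cinner_ell2 x (scale_ell2 c y) = cnj c * cinner_ell2 x y"
  by (metis cinner_ell2_scale_left cinner_ell2_commute complex_cnj_mult)

lemma cinner_ell2_zero [simp]: "cinner_ell2 0 y = 0" "cinner_ell2 x 0 = 0"
  using cinner_ell2_scale_left[of 0 0 y] cinner_ell2_scale_right[of x 0 0] by simp_all

lemma cinner_ell2_diff_left: "cinner_ell2 (x - y) z = cinner_ell2 x z - cinner_ell2 y z"
  using cinner_ell2_add_left[of "x - y" y z] by simp

lemma cinner_ell2_sum_left: "cinner_ell2 (\<Sum>i\<in>I. f i) y = (\<Sum>i\<in>I. cinner_ell2 (f i) y)"
  by (induction I rule: infinite_finite_induct) (auto simp: cinner_ell2_add_left)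

lemma cinner_ell2_sum_right: "cinner_ell2 x (\<Sum>i\<in>I. f i) = (\<Sum>i\<in>I. cinner_ell2 x (f i))"
  by (induction I rule: infinite_finite_induct) (auto simp: cinner_ell2_add_right)

lemma cinner_ell2_self: "cinner_ell2 x x = complex_of_real ((norm x)\<^sup>2)"
proof (rule complex_eqI)
  show "Re (cinner_ell2 x x) = Re (complex_of_real ((norm x)\<^sup>2))"
    by (simp add: Re_cinner_ell2_self norm_ell2_power2)
  have "cinner_ell2 x x = cnj (cinner_ell2 x x)" by (rule cinner_ell2_commute)
  then show "Im (cinner_ell2 x x) = Im (complex_of_real ((norm x)\<^sup>2))"
    by (metis Im_complex_of_real cnj.simps(2) neg_equal_zero)
qed

lemma cinner_ell2_basis_right [simp]: "cinner_ell2 x (basis_ell2 w) = Rep_ell2 x w"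
proof -
  have "cinner_ell2 x (basis_ell2 w) = (\<Sum>\<^sub>\<infinity>v. Rep_ell2 x v * cnj (if v = w then 1 else 0))"
    by (simp add: cinner_ell2.rep_eq)
  also have "\<dots> = (\<Sum>\<^sub>\<infinity>v\<in>{w}. Rep_ell2 x v)"
    by (rule infsum_cong_neutral) auto
  finally show ?thesis by simp
qed

lemma cinner_ell2_basis_left [simp]: "cinner_ell2 (basis_ell2 w) x = cnj (Rep_ell2 x w)"
  by (subst cinner_ell2_commute) simp

lemma norm_scale_ell2 [simp]: "norm (scale_ell2 c x) = cmod c * norm x"
proof -
  have "complex_of_real ((norm (scale_ell2 c x))\<^sup>2) = complex_of_real ((cmod c * norm x)\<^sup>2)"
    unfolding cinner_ell2_self[symmetric] cinner_ell2_scale_left cinner_ell2_scale_right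
    by (simp add: cinner_ell2_self power_mult_distrib mult.assoc[symmetric] complex_norm_square
        del: of_real_power)
  then have "(norm (scale_ell2 c x))\<^sup>2 = (cmod c * norm x)\<^sup>2" by (simp only: of_real_eq_iff)
  then show ?thesis by (simp add: power2_eq_iff_nonneg)
qed

text \<open>A unimodular multiple of \<open>x\<close> makes the inner product real and nonnegative,
  and then the real Cauchy-Schwarz inequality applies.\<close>

lemma cmod_cinner_ell2_le: "cmod (cinner_ell2 x y) \<le> norm x * norm y"
proof (cases "cinner_ell2 x y = 0")
  case False
  let ?z = "cinner_ell2 x y" and ?r = "complex_of_real (cmod (cinner_ell2 x y))"
  define c where "c = cnj ?z / ?r"
  have c: "cmod c = 1" using False by (simp add: c_def norm_divide)
  have "cnj ?z / ?r * ?z = (?z * cnj ?z) / ?r" by simp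
  also have "\<dots> = ?r * ?r / ?r"
    by (simp only: complex_norm_square[symmetric] power2_eq_square of_real_mult)
  also have "\<dots> = ?r" by simp
  finally have "cinner_ell2 (scale_ell2 c x) y = ?r"
    by (simp only: cinner_ell2_scale_left c_def)
  then have "cmod (cinner_ell2 x y) = inner (scale_ell2 c x) y"
    by (simp add: inner_ell2_def)
  also have "\<dots> \<le> norm (scale_ell2 c x) * norm y" by (rule norm_cauchy_schwarz)
  finally show ?thesis using c by simp
qed simp

lemma bounded_linear_cinner_ell2: "bounded_linear (\<lambda>x. cinner_ell2 x y)"
  by (rule bounded_linear_intro[where K = "norm y"])
    (simp_all add: cinner_ell2_add_left scaleR_ell2_def cinner_ell2_scale_left
      scaleR_conv_of_real cmod_cinner_ell2_le)

lemma bounded_linear_Rep_ell2: "bounded_linear (\<lambda>x. Rep_ell2 x w)"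
  using bounded_linear_cinner_ell2[of "basis_ell2 w"] by simp

lemma bounded_linear_scale_ell2: "bounded_linear (scale_ell2 c)"
  by (rule bounded_linear_intro[where K = "cmod c"])
    (auto simp: ell2.scale_right_distrib scaleR_ell2_def mult.commute)

section \<open>Coordinate projections and density of finitely supported vectors\<close>

lift_definition truncate_ell2 :: "'a set \<Rightarrow> 'a ell2 \<Rightarrow> 'a ell2" is
  "\<lambda>F f w. if w \<in> F then f w else 0"
  by (rule summable_on_comparison_test[rotated]) auto

declare truncate_ell2.rep_eq [simp]

lemma norm_truncate_ell2_Pythagoras:
  "(norm x)\<^sup>2 = (norm (truncate_ell2 F x))\<^sup>2 + (norm (x - truncate_ell2 F x))\<^sup>2"
proof -
  have "(cmod (Rep_ell2 x w))\<^sup>2 = (cmod (Rep_ell2 (truncate_ell2 F x) w))\<^sup>2 +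
      (cmod (Rep_ell2 (x - truncate_ell2 F x) w))\<^sup>2" for w
    by auto
  then show ?thesis
    unfolding norm_ell2_power2 by (simp only: infsum_add Rep_ell2_summable)
qed

lemma truncate_ell2_finite:
  assumes "finite F"
  shows "truncate_ell2 F x = (\<Sum>w\<in>F. scale_ell2 (Rep_ell2 x w) (basis_ell2 w))"
  using assms by (intro ell2_eqI) (simp add: if_distrib[of "\<lambda>c. Rep_ell2 x _ * c"] sum.delta cong: if_cong)

text \<open>The bound covers every larger set \<open>G\<close>, so that \<open>F\<close> may be
  enlarged to all words below a given length.\<close>

lemma truncate_ell2_approx:
  assumes "0 < e"
  obtains F where "finite F" "\<And>G. F \<subseteq> G \<Longrightarrow> norm (x - truncate_ell2 G x) < e"
proof -
  have "((\<lambda>w. (cmod (Rep_ell2 x w))\<^sup>2) has_sum (norm x)\<^sup>2) UNIV"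
    unfolding norm_ell2_power2 by (rule has_sum_infsum) simp
  then obtain F where F: "finite F"
      "\<bar>(norm x)\<^sup>2 - (\<Sum>w\<in>F. (cmod (Rep_ell2 x w))\<^sup>2)\<bar> < e\<^sup>2"
    using assms unfolding has_sum_def tendsto_iff eventually_finite_subsets_at_top dist_real_def
    by (metis abs_minus_commute order.refl subset_UNIV zero_less_power)
  have "norm (x - truncate_ell2 G x) < e" if "F \<subseteq> G" for G
  proof -
    have "(\<Sum>w\<in>F. (cmod (Rep_ell2 x w))\<^sup>2) = (\<Sum>w\<in>F. (cmod (Rep_ell2 (truncate_ell2 G x) w))\<^sup>2)"
      using that by (intro sum.cong) auto
    also have "\<dots> \<le> (norm (truncate_ell2 G x))\<^sup>2" by (rule sum_Rep_ell2_le_norm[OF F(1)])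
    finally have "(norm (x - truncate_ell2 G x))\<^sup>2 < e\<^sup>2"
      using F(2) norm_truncate_ell2_Pythagoras[of x G] by linarith
    then show ?thesis using assms by (simp add: power_less_imp_less_base[of _ 2])
  qed
  then show thesis using F(1) that by blast
qed

lemma closure_span_basis_ell2: "closure (ell2.span (range basis_ell2)) = UNIV"
proof -
  have "x \<in> closure (ell2.span (range basis_ell2))" for x :: "'a ell2"
    unfolding closure_approachable
  proof (intro allI impI)
    fix e :: real assume "0 < e"
    then obtain F where F: "finite F" "norm (x - truncate_ell2 F x) < e"
      using truncate_ell2_approx by (metis order_refl)
    have "truncate_ell2 F x \<in> ell2.span (range basis_ell2)"
      unfolding truncate_ell2_finite[OF F(1)]
      by (intro ell2.span_sum ell2.span_scale ell2.span_base) auto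
    then show "\<exists>y\<in>ell2.span (range basis_ell2). dist y x < e"
      using F(2) by (auto simp: dist_norm norm_minus_commute)
  qed
  then show ?thesis by blast
qed

lemma ell2_continuous_eq_on_basis:
  assumes "continuous_on UNIV f" "continuous_on UNIV (g :: 'a ell2 \<Rightarrow> 'b::t2_space)"
    and "\<And>x. x \<in> ell2.span (range basis_ell2) \<Longrightarrow> f x = g x"
  shows "f x = g x"
proof -
  have "closed {x. f x = g x}"
    using assms(1,2) by (simp add: closed_Collect_eq)
  then have "closure (ell2.span (range basis_ell2)) \<subseteq> {x. f x = g x}"
    using assms(3) by (intro closure_minimal) auto
  then show ?thesis by (auto simp: closure_span_basis_ell2)
qed

section \<open>Orthonormal and biorthogonal systems\<close>

definition orthonormal_ell2 :: "'a ell2 set \<Rightarrow> bool" where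
  "orthonormal_ell2 E \<longleftrightarrow> (\<forall>e\<in>E. \<forall>f\<in>E. cinner_ell2 e f = (if e = f then 1 else 0))"

text \<open>Pairing a vanishing combination with \<open>f i\<close> isolates the conjugate of the
  coefficient of \<open>g i\<close>.\<close>

lemma biorthogonal_independent:
  assumes "finite I"
    and bi: "\<And>i j. i \<in> I \<Longrightarrow> j \<in> I \<Longrightarrow> cinner_ell2 (f i) (g j) = (if i = j then 1 else 0)"
  shows "ell2.independent (g ` I)" and "inj_on g I"
proof -
  show inj: "inj_on g I" using bi by (metis inj_onI zero_neq_one)
  show "ell2.independent (g ` I)"
  proof (rule ell2.independent_if_scalars_zero)
    fix c x assume s: "(\<Sum>x\<in>g ` I. scale_ell2 (c x) x) = 0" and "x \<in> g ` I"
    then obtain i where i: "i \<in> I" "x = g i" by auto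
    have "0 = cinner_ell2 (f i) (\<Sum>x\<in>g ` I. scale_ell2 (c x) x)" by (simp add: s)
    also have "\<dots> = (\<Sum>j\<in>I. cnj (c (g j)) * (if i = j then 1 else 0))"
      by (auto simp: sum.reindex[OF inj] cinner_ell2_sum_right cinner_ell2_scale_right bi i
          intro!: sum.cong)
    also have "\<dots> = cnj (c x)"
      using assms(1) i by (simp add: if_distrib[of "\<lambda>a. _ * a"] cong: if_cong)
    finally show "c x = 0" by simp
  qed (use assms in auto)
qed

lemma orthonormal_ell2_independent:
  assumes "finite E" "orthonormal_ell2 E" shows "ell2.independent E"
  using biorthogonal_independent(1)[of E "\<lambda>x. x" "\<lambda>x. x"] assms unfolding orthonormal_ell2_def by simp

lemma orthonormal_ell2_expansion:
  assumes "finite E" "orthonormal_ell2 E" "x \<in> ell2.span E"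
  shows "x = (\<Sum>e\<in>E. scale_ell2 (cinner_ell2 x e) e)"
proof -
  obtain c where c: "x = (\<Sum>e\<in>E. scale_ell2 (c e) e)"
    using assms(1,3) by (auto simp: ell2.span_finite)
  have "cinner_ell2 x f = c f" if "f \<in> E" for f
    using assms(1,2) that unfolding orthonormal_ell2_def c
    by (simp add: cinner_ell2_sum_left cinner_ell2_scale_left if_distrib[of "\<lambda>a. _ * a"] cong: if_cong)
  then show ?thesis using c by simp
qed

lemma cinner_ell2_orthonormal_residual:
  assumes "finite E" "orthonormal_ell2 E" "f \<in> E"
  shows "cinner_ell2 (x - (\<Sum>e\<in>E. scale_ell2 (cinner_ell2 x e) e)) f = 0"
  using assms unfolding orthonormal_ell2_def
  by (simp add: cinner_ell2_diff_left cinner_ell2_sum_left cinner_ell2_scale_left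
      if_distrib[of "\<lambda>a. _ * a"] cong: if_cong)

text \<open>Gram-Schmidt started from a given system. Keeping \<open>E\<close> inside
  \<open>E'\<close> allows an orthogonal complement to be read off as the set difference.\<close>

lemma orthonormal_ell2_extend:
  assumes "finite F" "finite E" "orthonormal_ell2 E"
  obtains E' where "finite E'" "orthonormal_ell2 E'" "E \<subseteq> E'" "ell2.span E' = ell2.span (E \<union> F)"
  using assms(1)
proof (induction F arbitrary: thesis rule: finite_induct)
  case empty
  then show ?case using assms by auto
next
  case (insert x F)
  obtain E' where E': "finite E'" "orthonormal_ell2 E'" "E \<subseteq> E'" "ell2.span E' = ell2.span (E \<union> F)"
    using insert.IH by blast
  define p where "p = (\<Sum>e\<in>E'. scale_ell2 (cinner_ell2 x e) e)"
  define y where "y = x - p"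
  have p: "p \<in> ell2.span E'"
    unfolding p_def by (intro ell2.span_sum ell2.span_scale ell2.span_base)
  have span: "ell2.span (insert x E') = ell2.span (E \<union> insert x F)"
    using E'(4) by (metis Un_insert_right ell2.span_insert)
  have y: "cinner_ell2 y e = 0" "cinner_ell2 e y = 0" if "e \<in> E'" for e
    using cinner_ell2_orthonormal_residual[OF E'(1,2) that, of x] cinner_ell2_commute[of e y]
    by (auto simp: y_def p_def)
  show ?case
  proof (cases "y = 0")
    case True
    then have "ell2.span (insert x E') = ell2.span E'"
      using p by (intro ell2.span_redundant) (simp add: y_def)
    then show ?thesis using insert.prems E' span by auto
  next
    case False
    define z where "z = scale_ell2 (inverse (complex_of_real (norm y))) y"
    have yz: "y = scale_ell2 (complex_of_real (norm y)) z"
      using False by (simp add: z_def)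
    have "norm z = 1" using False by (simp add: z_def norm_inverse)
    then have zz: "cinner_ell2 z z = 1" by (simp add: cinner_ell2_self)
    have z: "cinner_ell2 z e = 0" "cinner_ell2 e z = 0" if "e \<in> E'" for e
      using y[OF that] by (simp_all add: z_def cinner_ell2_scale_left cinner_ell2_scale_right)
    have "orthonormal_ell2 (insert z E')"
      using E'(2) zz z unfolding orthonormal_ell2_def by auto
    moreover have "ell2.span (insert z E') = ell2.span (insert x E')"
    proof (rule ell2.span_eq[THEN iffD2], intro conjI subsetI)
      have "x = scale_ell2 (complex_of_real (norm y)) z + p" using yz by (simp add: y_def)
      also have "\<dots> \<in> ell2.span (insert z E')"
        using p by (intro ell2.span_add ell2.span_scale)
          (auto intro: ell2.span_base ell2.span_mono[THEN subsetD, of E'])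
      finally show "w \<in> ell2.span (insert z E')" if "w \<in> insert x E'" for w
        using that by (auto intro: ell2.span_base)
      have "x - p \<in> ell2.span (insert x E')"
        using p by (intro ell2.span_diff)
          (auto intro: ell2.span_base ell2.span_mono[THEN subsetD, of E'])
      then have "z \<in> ell2.span (insert x E')"
        unfolding z_def y_def by (rule ell2.span_scale)
      then show "w \<in> ell2.span (insert x E')" if "w \<in> insert z E'" for w
        using that by (auto intro: ell2.span_base)
    qed
    ultimately show ?thesis
      using insert.prems[of "insert z E'"] E' span by auto
  qed
qed

section \<open>Wandering vectors of kernels\<close>

lift_definition flip_ell2 :: "'a list ell2 \<Rightarrow> 'a list ell2" is "\<lambda>f w. f (rev w)"
  by (subst summable_on_reindex_bij_betw[of rev]) (auto intro: bij_betwI[of _ _ _ rev])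

declare flip_ell2.rep_eq [simp]

lemma flip_flip_ell2 [simp]: "flip_ell2 (flip_ell2 x) = x"
  by (rule ell2_eqI) simp

lemma flip_ell2_add: "flip_ell2 (x + y) = flip_ell2 x + flip_ell2 y"
  and flip_ell2_scale: "flip_ell2 (scale_ell2 c x) = scale_ell2 c (flip_ell2 x)"
  and flip_ell2_sum: "flip_ell2 (\<Sum>i\<in>I. f i) = (\<Sum>i\<in>I. flip_ell2 (f i))"
  and flip_ell2_basis: "flip_ell2 (basis_ell2 w) = basis_ell2 (rev w)"
  by (rule ell2_eqI; force)+

lemma cinner_flip_flip [simp]: "cinner_ell2 (flip_ell2 x) (flip_ell2 y) = cinner_ell2 x y"
  unfolding cinner_ell2.rep_eq flip_ell2.rep_eq
  by (rule infsum_reindex_bij_betw[of rev UNIV UNIV "\<lambda>w. Rep_ell2 x w * cnj (Rep_ell2 y w)"])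
    (auto intro: bij_betwI[of _ _ _ rev])

lemma cinner_flip_left: "cinner_ell2 (flip_ell2 x) y = cinner_ell2 x (flip_ell2 y)"
  by (metis cinner_flip_flip flip_flip_ell2)

lemma norm_flip_ell2 [simp]: "norm (flip_ell2 x) = norm x"
  by (simp add: norm_ell2_def inner_ell2_def)

lemma Rep_left_creation [simp]:
  "Rep_ell2 (left_creation i x) [] = 0"
  "Rep_ell2 (left_creation i x) (j # v) = (if j = i then Rep_ell2 x v else 0)"
  by (simp_all add: left_creation.rep_eq)

lemma Rep_left_creation_Cons: "Rep_ell2 (left_creation i x) w = (if w \<noteq> [] \<and> hd w = i then Rep_ell2 x (tl w) else 0)"
  by (cases w) auto

text \<open>The adjoint of \<open>left_creation i\<close>: it keeps the words beginning with
  \<open>i\<close> and strips that letter.\<close>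

lift_definition left_annihilation :: "'n \<Rightarrow> 'n list operator" is "\<lambda>i f w. f (i # w)"
proof -
  fix i :: 'n and f :: "'n list \<Rightarrow> complex"
  assume "(\<lambda>w. (cmod (f w))\<^sup>2) summable_on UNIV"
  then have "(\<lambda>w. (cmod (f w))\<^sup>2) summable_on range ((#) i)"
    by (rule summable_on_subset_banach) simp
  then show "(\<lambda>w. (cmod (f (i # w)))\<^sup>2) summable_on UNIV"
    by (subst (asm) summable_on_reindex) (auto simp: o_def)
qed

declare left_annihilation.rep_eq [simp]

lemma cinner_left_creation_left: "cinner_ell2 (left_creation i x) y = cinner_ell2 x (left_annihilation i y)"
proof -
  have "cinner_ell2 (left_creation i x) y =
      (\<Sum>\<^sub>\<infinity>w\<in>range ((#) i). Rep_ell2 (left_creation i x) w * cnj (Rep_ell2 y w))"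
    unfolding cinner_ell2.rep_eq by (rule infsum_cong_neutral) (auto simp: Rep_left_creation_Cons neq_Nil_conv)
  also have "\<dots> = cinner_ell2 x (left_annihilation i y)"
    unfolding cinner_ell2.rep_eq by (subst infsum_reindex) (auto simp: o_def)
  finally show ?thesis .
qed

lemma cinner_left_creation_right: "cinner_ell2 x (left_creation i y) = cinner_ell2 (left_annihilation i x) y"
  by (metis cinner_left_creation_left cinner_ell2_commute)

lemma left_annihilation_creation [simp]:
  "left_annihilation i (left_creation j x) = (if i = j then x else 0)"
  by (rule ell2_eqI) simp

lemma left_creation_linear:
  "left_creation i (x + y) = left_creation i x + left_creation i y"
  "left_creation i (scale_ell2 c x) = scale_ell2 c (left_creation i x)"
  "left_creation i (\<Sum>k\<in>K. f k) = (\<Sum>k\<in>K. left_creation i (f k))"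
  "left_creation i 0 = 0"
  by (rule ell2_eqI; simp add: Rep_left_creation_Cons)+

lemma cinner_left_creation [simp]:
  "cinner_ell2 (left_creation i x) (left_creation j y) = (if i = j then cinner_ell2 x y else 0)"
  by (simp add: cinner_left_creation_left)

lemma norm_left_creation [simp]: "norm (left_creation i x) = norm x"
  by (simp add: norm_ell2_def inner_ell2_def)

lemma bounded_linear_left_creation: "bounded_linear (left_creation i)"
  by (rule bounded_linear_intro[where K = 1]) (auto simp: left_creation_linear scaleR_ell2_def)

lemma ell2_left_decomposition:
  fixes x :: "'n::finite list ell2"
  shows "x = scale_ell2 (Rep_ell2 x []) (basis_ell2 []) + (\<Sum>i\<in>UNIV. left_creation i (left_annihilation i x))"
proof (rule ell2_eqI)
  fix w show "Rep_ell2 x w = Rep_ell2 (scale_ell2 (Rep_ell2 x []) (basis_ell2 []) +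
      (\<Sum>i\<in>UNIV. left_creation i (left_annihilation i x))) w"
    by (cases w) auto
qed

lemma norm_sum_left_creation:
  fixes y :: "'n::finite \<Rightarrow> 'n list ell2"
  shows "(norm (\<Sum>i\<in>UNIV. left_creation i (y i)))\<^sup>2 = (\<Sum>i\<in>UNIV. (norm (y i))\<^sup>2)"
proof -
  have "complex_of_real ((norm (\<Sum>i\<in>UNIV. left_creation i (y i)))\<^sup>2) = complex_of_real (\<Sum>i\<in>UNIV. (norm (y i))\<^sup>2)"
    unfolding cinner_ell2_self[symmetric] of_real_sum
    by (simp add: cinner_ell2_sum_left cinner_ell2_sum_right)
  then show ?thesis by (simp only: of_real_eq_iff)
qed

section \<open>The wandering space of an invariant subspace of finite codimension\<close>

text \<open>The \<open>a s\<close> span the orthogonal complement of \<open>M\<close>, and the dual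
  system \<open>q\<close> supplies a finite-rank correction onto \<open>M\<close>, in general an
  oblique projection. The assumption \<open>inv\<close> is invariance of \<open>M\<close> under left
  creation.\<close>

locale biorthogonal_family =
  fixes a q :: "'s::finite \<Rightarrow> 'n::finite list ell2"
  assumes bi: "cinner_ell2 (q s) (a t) = (if s = t then 1 else 0)"
    and inv: "(\<And>t. cinner_ell2 x (a t) = 0) \<Longrightarrow> cinner_ell2 (left_creation i x) (a s) = 0"
begin

definition M :: "'n list ell2 set" where
  "M = {x. \<forall>s. cinner_ell2 x (a s) = 0}"

lemma M_projection: "x - (\<Sum>s\<in>UNIV. scale_ell2 (cinner_ell2 x (a s)) (q s)) \<in> M"
  by (auto simp: M_def cinner_ell2_diff_left cinner_ell2_sum_left cinner_ell2_scale_left bi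
      if_distrib[of "\<lambda>c. _ * c"] cong: if_cong)

text \<open>The oblique projection of each basis vector lies in \<open>M\<close>. Orthogonality of
  \<open>y\<close> to it expresses the coordinate of \<open>y\<close> at that word through the
  finitely many \<open>a s\<close>, with coefficients independent of the word.\<close>

lemma span_a_if_orthogonal_M:
  assumes "\<And>x. x \<in> M \<Longrightarrow> cinner_ell2 x y = 0"
  shows "y \<in> ell2.span (range a)"
proof -
  have "y = (\<Sum>s\<in>UNIV. scale_ell2 (cinner_ell2 y (q s)) (a s))"
  proof (rule ell2_eqI)
    fix w
    have "cinner_ell2 (basis_ell2 w) y =
        (\<Sum>s\<in>UNIV. cinner_ell2 (basis_ell2 w) (a s) * cinner_ell2 (q s) y)"
      using assms[OF M_projection[of "basis_ell2 w"]]
      by (simp add: cinner_ell2_diff_left cinner_ell2_sum_left cinner_ell2_scale_left)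
    then have "cnj (Rep_ell2 y w) = cnj (\<Sum>s\<in>UNIV. Rep_ell2 (a s) w * cnj (cinner_ell2 (q s) y))"
      by simp
    then show "Rep_ell2 y w = Rep_ell2 (\<Sum>s\<in>UNIV. scale_ell2 (cinner_ell2 y (q s)) (a s)) w"
      unfolding complex_cnj_cancel_iff
      by (simp add: cinner_ell2_commute[of y] mult.commute)
  qed
  also have "\<dots> \<in> ell2.span (range a)"
    by (intro ell2.span_sum ell2.span_scale ell2.span_base) auto
  finally show ?thesis .
qed

text \<open>\<open>cover\<close> spans the orthogonal complement of \<open>\<Sum>\<^sub>i L\<^sub>i M\<close>.\<close>

definition cover :: "('n \<times> 's) option \<Rightarrow> 'n list ell2" where
  "cover k = (case k of None \<Rightarrow> basis_ell2 [] | Some (i, s) \<Rightarrow> left_creation i (a s))"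

lemma span_cover_if_annihilation:
  assumes "\<And>i. left_annihilation i x \<in> ell2.span (range a)"
  shows "x \<in> ell2.span (range cover)"
proof -
  have L: "left_creation i y \<in> ell2.span (range cover)" if "y \<in> ell2.span (range a)" for i y
    using that
  proof (induction rule: ell2.span_induct_alt)
    case (step c z y)
    then obtain s where "z = a s" by auto
    then have "left_creation i z = cover (Some (i, s))" by (simp add: cover_def)
    then have "left_creation i z \<in> ell2.span (range cover)"
      by (metis ell2.span_base rangeI)
    then show ?case
      using step by (simp add: left_creation_linear ell2.span_add ell2.span_scale)
  qed (simp add: left_creation_linear ell2.span_zero)
  have "basis_ell2 [] = cover None" by (simp add: cover_def)
  then have "basis_ell2 [] \<in> ell2.span (range cover)" by (metis ell2.span_base rangeI)
  then show ?thesis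
    using L assms by (subst ell2_left_decomposition) (intro ell2.span_add ell2.span_sum ell2.span_scale; blast)
qed

text \<open>Invariance of \<open>M\<close> under left creation means that its complement is
  invariant under left annihilation; \<open>ell2_left_decomposition\<close> then reassembles
  \<open>a s\<close> from the vacuum and vectors created from that complement.\<close>

lemma a_in_span_cover: "a s \<in> ell2.span (range cover)"
proof (rule span_cover_if_annihilation, rule span_a_if_orthogonal_M)
  fix i x assume "x \<in> M"
  then show "cinner_ell2 x (left_annihilation i (a s)) = 0"
    using inv[of x] by (simp add: M_def cinner_left_creation_left[symmetric])
qed

lemma cover_independent: "ell2.independent (range cover)" "card (range cover) = Suc (CARD('n) * CARD('s))"
proof -
  \<comment> \<open>The construction of \<open>cover\<close>, applied to \<open>q\<close> instead of
    \<open>a\<close>, is a dual system for \<open>cover\<close>.\<close>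
  define r :: "('n \<times> 's) option \<Rightarrow> 'n list ell2" where
    "r k = (case k of None \<Rightarrow> basis_ell2 [] | Some (i, s) \<Rightarrow> left_creation i (q s))" for k
  have "cinner_ell2 (r k) (cover l) = (if k = l then 1 else 0)" for k l
    by (auto simp: r_def cover_def bi split: option.splits)
  then have "ell2.independent (range cover)" "inj cover"
    using biorthogonal_independent[of "UNIV :: ('n \<times> 's) option set" r cover] by auto
  then show "ell2.independent (range cover)" "card (range cover) = Suc (CARD('n) * CARD('s))"
    by (auto simp: card_image card_UNIV_option)
qed

lemma a_independent: "ell2.independent (range a)" "card (range a) = CARD('s)"
proof -
  have "ell2.independent (range a)" "inj a"
    using biorthogonal_independent[of "UNIV :: 's set" q a] bi by auto
  then show "ell2.independent (range a)" "card (range a) = CARD('s)"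
    by (auto simp: card_image)
qed

lemma M_left_creation: "x \<in> M \<Longrightarrow> left_creation i x \<in> M"
  using inv by (simp add: M_def)

lemma subspace_M: "ell2.subspace M"
  by (rule ell2.subspaceI) (auto simp: M_def cinner_ell2_add_left cinner_ell2_scale_left)

lemma orthogonal_to_span:
  assumes "x \<in> ell2.span B" "\<And>b. b \<in> B \<Longrightarrow> cinner_ell2 y b = 0"
  shows "cinner_ell2 y x = 0"
  using assms(1)
  by (induction rule: ell2.span_induct_alt)
    (auto simp: assms(2) cinner_ell2_add_right cinner_ell2_scale_right)

lemma wandering_space_iff:
  "x \<in> wandering_space M \<longleftrightarrow> x \<in> M \<and> (\<forall>i. \<forall>y\<in>M. cinner_ell2 x (left_creation i y) = 0)"
proof
  assume x: "x \<in> wandering_space M"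
  have "cinner_ell2 x (left_creation i y) = 0" if "y \<in> M" for i y
  proof -
    define f where "f j = (if j = i then y else 0)" for j
    have "f j \<in> M" for j
      using that ell2.subspace_0[OF subspace_M] by (simp add: f_def)
    then have "cinner_ell2 x (\<Sum>j\<in>UNIV. left_creation j (f j)) = 0"
      using x by (simp add: wandering_space_def)
    moreover have "left_creation j (f j) = (if j = i then left_creation i y else 0)" for j
      by (simp add: f_def left_creation_linear)
    ultimately show ?thesis by simp
  qed
  then show "x \<in> M \<and> (\<forall>i. \<forall>y\<in>M. cinner_ell2 x (left_creation i y) = 0)"
    using x by (auto simp: wandering_space_def)
qed (simp add: wandering_space_def cinner_ell2_sum_right)

text \<open>The basis \<open>E\<close> is what remains of an orthonormal basis of the span of
  \<open>cover\<close> after removing one of the span of \<open>a\<close>. The last clause is one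
  step of the Wold decomposition: subtracting the wandering part of \<open>x\<close> leaves a vector
  orthogonal to \<open>cover\<close>, which has no vacuum coordinate and whose annihilations lie in
  \<open>M\<close>. The norm bound is Pythagoras and keeps iteration under control.\<close>

lemma wandering_orthonormal_basis:
  obtains E where "finite E" "orthonormal_ell2 E" "card E = 1 + (CARD('n) - 1) * CARD('s)"
    "E \<subseteq> wandering_space M" "wandering_space M \<subseteq> ell2.span E"
    "\<And>x. x \<in> M \<Longrightarrow> \<exists>y. (\<forall>i. y i \<in> M) \<and> (\<Sum>i\<in>UNIV. (norm (y i))\<^sup>2) \<le> (norm x)\<^sup>2 \<and>
       x = (\<Sum>e\<in>E. scale_ell2 (cinner_ell2 x e) e) + (\<Sum>i\<in>UNIV. left_creation i (y i))"
proof -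
  obtain E0 where E0: "finite E0" "orthonormal_ell2 E0" "ell2.span E0 = ell2.span (range a)"
    using orthonormal_ell2_extend[of "range a" "{}"] by (auto simp: orthonormal_ell2_def)
  obtain E' where E': "finite E'" "orthonormal_ell2 E'" "E0 \<subseteq> E'" "ell2.span E' = ell2.span (E0 \<union> range cover)"
    using orthonormal_ell2_extend[of "range cover" E0] E0 by auto
  have "ell2.span E0 \<subseteq> ell2.span (range cover)"
    unfolding E0(3) using a_in_span_cover by (intro ell2.span_minimal ell2.subspace_span) auto
  then have "E0 \<subseteq> ell2.span (range cover)"
    using ell2.span_superset by blast
  then have span': "ell2.span E' = ell2.span (range cover)"
    unfolding E'(4) by (subst ell2.span_eq) (auto intro: ell2.span_base)
  define E where "E = E' - E0"
  have card0: "card E0 = CARD('s)"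
    using E0 a_independent orthonormal_ell2_independent[OF E0(1,2)] by (metis ell2.dim_span_eq_card_independent)
  have card': "card E' = Suc (CARD('n) * CARD('s))"
    using E' span' cover_independent orthonormal_ell2_independent[OF E'(1,2)]
    by (metis ell2.dim_span_eq_card_independent)
  have orth0: "cinner_ell2 x e = 0" if "x \<in> M" "e \<in> E0" for x e
    using that E0(3) orthogonal_to_span[of e "range a" x] ell2.span_base[of e E0] by (auto simp: M_def)
  have card_E: "card E = 1 + (CARD('n) - 1) * CARD('s)"
  proof -
    have "card E = Suc (CARD('n) * CARD('s)) - CARD('s)"
      unfolding E_def using E'(1,3) E0(1) by (simp add: card_Diff_subset card0 card')
    \<comment> \<open>Naming the predecessor of the alphabet size removes the truncated
      subtraction.\<close>
    moreover obtain k where "CARD('n) = Suc k"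
      using not0_implies_Suc[of "CARD('n)"] by auto
    ultimately show ?thesis by simp
  qed
  have E_sub: "E \<subseteq> wandering_space M"
  proof
    fix e assume e: "e \<in> E"
    have "cinner_ell2 e (a s) = 0" for s
    proof (rule orthogonal_to_span[of _ E0])
      show "a s \<in> ell2.span E0" using E0(3) by (auto intro: ell2.span_base)
      show "cinner_ell2 e b = 0" if "b \<in> E0" for b
        using that e E'(2,3) unfolding E_def orthonormal_ell2_def by auto
    qed
    then have "e \<in> M" by (simp add: M_def)
    moreover have "cinner_ell2 e (left_creation i y) = 0" if "y \<in> M" for i y
    proof -
      have "cinner_ell2 (left_creation i y) e = 0"
      proof (rule orthogonal_to_span[of _ "range cover"])
        show "e \<in> ell2.span (range cover)"
          using e span' ell2.span_base[of e E'] by (auto simp: E_def)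
        fix b assume "b \<in> range cover"
        then show "cinner_ell2 (left_creation i y) b = 0"
          using that by (auto simp: cover_def M_def split: option.splits)
      qed
      then show ?thesis by (metis cinner_ell2_commute complex_cnj_zero)
    qed
    ultimately show "e \<in> wandering_space M" by (auto simp: wandering_space_iff)
  qed
  have W_span: "x \<in> ell2.span E" if "x \<in> wandering_space M" for x
  proof -
    have x: "x \<in> M" "\<And>i y. y \<in> M \<Longrightarrow> cinner_ell2 x (left_creation i y) = 0"
      using that by (auto simp: wandering_space_iff)
    have "left_annihilation i x \<in> ell2.span (range a)" for i
    proof (rule span_a_if_orthogonal_M)
      fix y assume "y \<in> M"
      then show "cinner_ell2 y (left_annihilation i x) = 0"
        using x(2)[of y i] cinner_ell2_commute[of x]
        by (simp add: cinner_left_creation_left[symmetric])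
    qed
    then have "x \<in> ell2.span E'"
      using span_cover_if_annihilation span' by simp
    then have "x = (\<Sum>e\<in>E'. scale_ell2 (cinner_ell2 x e) e)"
      by (rule orthonormal_ell2_expansion[OF E'(1,2)])
    also have "\<dots> = (\<Sum>e\<in>E. scale_ell2 (cinner_ell2 x e) e)"
      unfolding E_def using E'(1) orth0[OF x(1)] by (intro sum.mono_neutral_right) auto
    also have "\<dots> \<in> ell2.span E"
      by (intro ell2.span_sum ell2.span_scale ell2.span_base)
    finally show ?thesis .
  qed
  have dec: "\<exists>y. (\<forall>i. y i \<in> M) \<and> (\<Sum>i\<in>UNIV. (norm (y i))\<^sup>2) \<le> (norm x)\<^sup>2 \<and>
       x = (\<Sum>e\<in>E. scale_ell2 (cinner_ell2 x e) e) + (\<Sum>i\<in>UNIV. left_creation i (y i))"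
    if x: "x \<in> M" for x
  proof -
    define p where "p = (\<Sum>e\<in>E. scale_ell2 (cinner_ell2 x e) e)"
    define z where "z = x - p"
    define y where "y i = left_annihilation i z" for i
    have E: "finite E" "orthonormal_ell2 E" using E'(1,2) by (auto simp: E_def orthonormal_ell2_def)
    have zE: "cinner_ell2 z e = 0" if "e \<in> E" for e
      unfolding z_def p_def using cinner_ell2_orthonormal_residual[OF E that] .
    have "p \<in> M" unfolding p_def
      using E_sub by (intro ell2.subspace_sum[OF subspace_M] ell2.subspace_scale[OF subspace_M])
        (auto simp: wandering_space_def)
    then have "z \<in> M" unfolding z_def using x ell2.subspace_diff[OF subspace_M] by blast
    then have zE': "cinner_ell2 z e = 0" if "e \<in> E'" for e
      using zE orth0[of z e] that by (auto simp: E_def)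
    have z_cover: "cinner_ell2 z (cover k) = 0" for k
    proof (rule orthogonal_to_span[of _ E'])
      show "cover k \<in> ell2.span E'" unfolding span' by (auto intro: ell2.span_base)
    qed (rule zE')
    have "y i \<in> M" for i
      using z_cover[of "Some (i, _)"] by (auto simp: M_def y_def cover_def cinner_left_creation_right)
    moreover have z: "z = (\<Sum>i\<in>UNIV. left_creation i (y i))"
      using ell2_left_decomposition[of z] z_cover[of None] by (simp add: cover_def y_def)
    moreover have "(norm z)\<^sup>2 \<le> (norm x)\<^sup>2"
    proof -
      have "cinner_ell2 z p = 0"
        unfolding p_def by (simp add: cinner_ell2_sum_right cinner_ell2_scale_right zE)
      then have "orthogonal z p" by (simp add: orthogonal_def inner_ell2_def)
      then have "(norm (z + p))\<^sup>2 = (norm z)\<^sup>2 + (norm p)\<^sup>2"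
        by (rule norm_add_Pythagorean)
      then show ?thesis by (simp add: z_def)
    qed
    moreover have "x = p + z" by (simp add: z_def)
    ultimately have "(\<forall>i. y i \<in> M) \<and> (\<Sum>i\<in>UNIV. (norm (y i))\<^sup>2) \<le> (norm x)\<^sup>2 \<and>
        x = p + (\<Sum>i\<in>UNIV. left_creation i (y i))"
      using norm_sum_left_creation[of y] by simp
    then show ?thesis unfolding p_def by blast
  qed
  have "finite E" "orthonormal_ell2 E" using E'(1,2) by (auto simp: E_def orthonormal_ell2_def)
  then show thesis using card_E E_sub subsetI[OF W_span] dec by (rule that)
qed

lemma dim_wandering_space: "ell2.dim (wandering_space M) = 1 + (CARD('n) - 1) * CARD('s)"
proof -
  obtain E where "finite E" "orthonormal_ell2 E" "card E = 1 + (CARD('n) - 1) * CARD('s)"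
    "E \<subseteq> wandering_space M" "wandering_space M \<subseteq> ell2.span E"
    by (rule wandering_orthonormal_basis)
  then show ?thesis
    using orthonormal_ell2_independent by (intro ell2.dim_unique)
qed

end

definition left_word :: "'n list \<Rightarrow> 'n list operator" where
  "left_word w = foldr left_creation w"

lemma left_word_simps [simp]:
  "left_word [] x = x" "left_word (i # w) x = left_creation i (left_word w x)"
  by (simp_all add: left_word_def)

lemma (in biorthogonal_family) M_left_word: "x \<in> M \<Longrightarrow> left_word w x \<in> M"
  by (induction w) (auto intro: M_left_creation)

text \<open>Equal first letters cancel, distinct ones give orthogonal ranges. If one word ends
  first, the other vector lies in \<open>left_creation i\<close> applied to \<open>M\<close>, to
  which \<open>e\<close> is orthogonal.\<close>

lemma (in biorthogonal_family) wandering_left_word_orthonormal: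
  assumes "e \<in> wandering_space M" "norm e = 1"
  shows "cinner_ell2 (left_word u e) (left_word v e) = (if u = v then 1 else 0)"
proof -
  have e: "e \<in> M" "\<And>i y. y \<in> M \<Longrightarrow> cinner_ell2 e (left_creation i y) = 0"
    using assms(1) unfolding wandering_space_iff by blast+
  have e': "cinner_ell2 (left_creation i y) e = 0" if "y \<in> M" for i y
    using that e(2)[of y i] cinner_ell2_commute[of "left_creation i y" e] by simp
  have W: "left_word w e \<in> M" for w by (rule M_left_word[OF e(1)])
  show ?thesis
  proof (induction u arbitrary: v)
    case Nil
    then show ?case
      using e(2)[OF W] assms(2) by (cases v) (simp_all add: cinner_ell2_self)
  next
    case (Cons i u)
    have "cinner_ell2 (left_word u e) (left_word u e) = 1" by (simp add: Cons.IH)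
    then show ?case by (cases v) (auto simp: Cons.IH e'[OF W])
  qed
qed

section \<open>The free semigroup algebra as a commutant\<close>

text \<open>Appends the letter \<open>i\<close>. Conjugation by reversal transfers the adjoint
  calculus of left creation.\<close>

definition right_creation :: "'n \<Rightarrow> 'n list operator" where
  "right_creation i x = flip_ell2 (left_creation i (flip_ell2 x))"

lemma Rep_right_creation:
  "Rep_ell2 (right_creation i x) u = (if u \<noteq> [] \<and> last u = i then Rep_ell2 x (butlast u) else 0)"
  by (cases u rule: rev_cases) (auto simp: right_creation_def)

lemma right_creation_basis: "right_creation i (basis_ell2 w) = basis_ell2 (w @ [i])"
  by (simp add: right_creation_def flip_ell2_basis left_creation_basis)

lemma right_creation_linear:
  "right_creation i (x + y) = right_creation i x + right_creation i y"
  "right_creation i (scale_ell2 c x) = scale_ell2 c (right_creation i x)"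
  by (rule ell2_eqI; simp add: Rep_right_creation)+

lemma left_right_creation: "left_creation j (right_creation i x) = right_creation i (left_creation j x)"
proof (rule ell2_eqI)
  fix u show "Rep_ell2 (left_creation j (right_creation i x)) u = Rep_ell2 (right_creation i (left_creation j x)) u"
  proof (cases u)
    case (Cons a v)
    then show ?thesis by (cases v rule: rev_cases) (auto simp: Rep_right_creation)
  qed (simp add: Rep_right_creation)
qed

lemma bounded_operators_linear:
  assumes "X \<in> bounded_operators"
  shows "X (x + y) = X x + X y" "X (scale_ell2 c x) = scale_ell2 c (X x)" "X 0 = 0"
    "X (\<Sum>k\<in>K. f k) = (\<Sum>k\<in>K. X (f k))" "bounded_linear X"
proof -
  interpret bounded_linear X using assms by (simp add: bounded_operators_def)
  show "X (x + y) = X x + X y" "X 0 = 0" "X (\<Sum>k\<in>K. f k) = (\<Sum>k\<in>K. X (f k))" "bounded_linear X"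
    by (rule add zero sum bounded_linear_axioms)+
  show "X (scale_ell2 c x) = scale_ell2 c (X x)" using assms by (simp add: bounded_operators_def)
qed

abbreviation creation_algebra :: "'n list operator set" where
  "creation_algebra \<equiv> generated_algebra id op_add (\<circ>) op_scale (range left_creation)"

lemma bounded_operators_op_add:
  "X \<in> bounded_operators \<Longrightarrow> Y \<in> bounded_operators \<Longrightarrow> op_add X Y \<in> bounded_operators"
  by (simp add: bounded_operators_def op_add_def bounded_linear_add ell2.scale_right_distrib)

lemma bounded_operators_comp:
  "X \<in> bounded_operators \<Longrightarrow> Y \<in> bounded_operators \<Longrightarrow> X \<circ> Y \<in> bounded_operators"
  by (simp add: bounded_operators_def bounded_linear_compose o_def)

lemma bounded_operators_op_scale:
  "X \<in> bounded_operators \<Longrightarrow> op_scale c X \<in> bounded_operators"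
  using bounded_linear_compose[OF bounded_linear_scale_ell2, of X c]
  by (simp add: bounded_operators_def op_scale_def ell2.scale_left_commute)

lemma creation_algebra_bounded: "X \<in> creation_algebra \<Longrightarrow> X \<in> bounded_operators"
proof (induction rule: generated_algebra.induct)
  case (generator x)
  then show ?case
    by (auto simp: bounded_operators_def bounded_linear_left_creation left_creation_linear)
next
  case one
  then show ?case using bounded_linear_ident by (simp add: bounded_operators_def id_def)
qed (rule bounded_operators_op_add bounded_operators_comp bounded_operators_op_scale; assumption)+

lemma creation_algebra_commute:
  "X \<in> creation_algebra \<Longrightarrow> X (right_creation i x) = right_creation i (X x)"
proof (induction arbitrary: x rule: generated_algebra.induct)
  case (generator X)
  then show ?case by (auto simp: left_right_creation)
qed (simp_all add: op_add_def op_scale_def right_creation_linear)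

lemma topspace_wot: "topspace wot = bounded_operators"
  by (simp add: wot_def topspace_pullback_topology)

text \<open>The weak operator topology is pulled back along the family of all matrix coefficients;
  \<open>h\<close> picks out one of them or combines finitely many.\<close>

lemma continuous_map_wotI:
  assumes "continuous_on UNIV h"
  shows "continuous_map wot euclidean (\<lambda>T. h (\<lambda>(x, y). cinner_ell2 (T x) y))"
proof -
  have "continuous_map wot euclidean (h \<circ> (\<lambda>T (x, y). cinner_ell2 (T x) y))"
    unfolding wot_def by (rule continuous_map_pullback) (simp add: assms)
  then show ?thesis by (simp add: o_def)
qed

lemma continuous_map_wot_matrix_coefficient: "continuous_map wot euclidean (\<lambda>T. cinner_ell2 (T x) y)"
  using continuous_map_wotI[of "\<lambda>F. F (x, y)"] by (simp add: continuous_on_product_coordinates)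

lemma free_semigroup_algebra_bounded: "X \<in> free_semigroup_algebra \<Longrightarrow> X \<in> bounded_operators"
  unfolding free_semigroup_algebra_def
  using closure_of_subset_topspace[of wot] by (auto simp: topspace_wot)

lemma creation_algebra_subset: "creation_algebra \<subseteq> free_semigroup_algebra"
  unfolding free_semigroup_algebra_def
  by (rule closure_of_subset) (auto simp: topspace_wot creation_algebra_bounded)

text \<open>Identities pass from the generated algebra to its closure one coordinate or matrix entry
  at a time, where both sides are complex functionals of the operator.\<close>

lemma free_semigroup_algebra_functional_eq:
  fixes f g :: "'n list operator \<Rightarrow> complex"
  assumes "X \<in> free_semigroup_algebra" "continuous_map wot euclidean f" "continuous_map wot euclidean g"
    and "\<And>T. T \<in> creation_algebra \<Longrightarrow> f T = g T"
  shows "f X = g X"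
  using assms unfolding free_semigroup_algebra_def
  by (intro forall_in_closure_of_eq[of X wot creation_algebra euclidean f g]) simp_all

lemma free_semigroup_algebra_commute:
  assumes "X \<in> free_semigroup_algebra"
  shows "X (right_creation i x) = right_creation i (X x)"
proof (rule ell2_eqI)
  fix u
  \<comment> \<open>A coordinate of \<open>right_creation i z\<close> is the inner product of
    \<open>z\<close> with a fixed vector, so both sides of the commutation relation become matrix
    coefficients of \<open>X\<close>.\<close>
  have R: "Rep_ell2 (right_creation i z) u =
      cinner_ell2 z (flip_ell2 (left_annihilation i (flip_ell2 (basis_ell2 u))))" for z
  proof -
    have "cinner_ell2 (right_creation i z) (basis_ell2 u) =
        cinner_ell2 z (flip_ell2 (left_annihilation i (flip_ell2 (basis_ell2 u))))"
      by (simp only: right_creation_def cinner_flip_left cinner_left_creation_left)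
    then show ?thesis by simp
  qed
  have "cinner_ell2 (X (right_creation i x)) (basis_ell2 u) =
      cinner_ell2 (X x) (flip_ell2 (left_annihilation i (flip_ell2 (basis_ell2 u))))"
    by (rule free_semigroup_algebra_functional_eq[OF assms continuous_map_wot_matrix_coefficient
          continuous_map_wot_matrix_coefficient])
      (simp add: creation_algebra_commute R[symmetric])
  then show "Rep_ell2 (X (right_creation i x)) u = Rep_ell2 (right_creation i (X x)) u"
    by (simp add: R)
qed

section \<open>Convolution operators and their Fejer means\<close>

text \<open>Left multiplication by the formal series \<open>f\<close>. The sum runs over the
  splittings of \<open>u\<close> into prefix and suffix, hence is finite for every
  \<open>u\<close>.\<close>

definition left_convolution :: "'n list operator \<Rightarrow> 'n list ell2 \<Rightarrow> bool" where
  "left_convolution X f \<longleftrightarrow> X \<in> bounded_operators \<and>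
     (\<forall>x u. Rep_ell2 (X x) u = (\<Sum>k\<le>length u. Rep_ell2 f (take k u) * Rep_ell2 x (drop k u)))"

text \<open>Basis vectors arise from the vacuum by right creation, so commutation determines
  \<open>X\<close> on them. For fixed \<open>u\<close> both sides are continuous and linear in
  \<open>x\<close>, and the basis vectors span a dense subspace.\<close>

lemma right_commutant_left_convolution:
  fixes X :: "'n list operator"
  assumes X: "X \<in> bounded_operators" and comm: "\<And>i x. X (right_creation i x) = right_creation i (X x)"
  shows "left_convolution X (X (basis_ell2 []))"
proof -
  let ?f = "X (basis_ell2 [])"
  have basis: "Rep_ell2 (X (basis_ell2 w)) u =
      (\<Sum>k\<le>length u. Rep_ell2 ?f (take k u) * Rep_ell2 (basis_ell2 w) (drop k u))" for w u
  proof (induction w arbitrary: u rule: rev_induct)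
    case Nil
    have "(\<Sum>k\<le>length u. Rep_ell2 ?f (take k u) * Rep_ell2 (basis_ell2 []) (drop k u)) =
        (\<Sum>k\<in>{length u}. Rep_ell2 ?f (take k u))"
      by (rule sum.mono_neutral_cong_right) auto
    then show ?case by simp
  next
    case (snoc i w)
    have X': "X (basis_ell2 (w @ [i])) = right_creation i (X (basis_ell2 w))"
      by (simp add: comm[symmetric] right_creation_basis)
    show ?case
    proof (cases u rule: rev_cases)
      case Nil then show ?thesis by (simp add: X' Rep_right_creation)
    next
      case (snoc v j)
      have eq: "(drop k v @ [j] = w @ [i]) \<longleftrightarrow> j = i \<and> drop k v = w" for k by auto
      show ?thesis
        using snoc.IH[of v]
        by (auto simp: snoc X' Rep_right_creation sum.atMost_Suc eq intro!: sum.cong)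
    qed
  qed
  have lin: "Rep_ell2 (X x) u = (\<Sum>k\<le>length u. Rep_ell2 ?f (take k u) * Rep_ell2 x (drop k u))" for x u
  proof (rule ell2_continuous_eq_on_basis[where x = x])
    show "continuous_on UNIV (\<lambda>x. Rep_ell2 (X x) u)"
      using bounded_linear_compose[OF bounded_linear_Rep_ell2 bounded_operators_linear(5)[OF X]]
      by (rule linear_continuous_on)
    show "continuous_on UNIV (\<lambda>x. \<Sum>k\<le>length u. Rep_ell2 ?f (take k u) * Rep_ell2 x (drop k u))"
      by (intro continuous_on_sum continuous_on_mult continuous_on_const
          linear_continuous_on bounded_linear_Rep_ell2)
    show "Rep_ell2 (X x) u = (\<Sum>k\<le>length u. Rep_ell2 ?f (take k u) * Rep_ell2 x (drop k u))"
      if "x \<in> ell2.span (range basis_ell2)" for x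
      using that
    proof (induction rule: ell2.span_induct_alt)
      case base
      then show ?case by (simp add: bounded_operators_linear(3)[OF X])
    next
      case (step c x y)
      then obtain w where "x = basis_ell2 w" by auto
      have "Rep_ell2 (X (scale_ell2 c x + y)) u = c * Rep_ell2 (X x) u + Rep_ell2 (X y) u"
        by (simp add: bounded_operators_linear(1,2)[OF X])
      also have "\<dots> = c * (\<Sum>k\<le>length u. Rep_ell2 ?f (take k u) * Rep_ell2 x (drop k u)) +
          (\<Sum>k\<le>length u. Rep_ell2 ?f (take k u) * Rep_ell2 y (drop k u))"
        by (simp only: \<open>x = basis_ell2 w\<close> basis[of w u] step(2))
      also have "\<dots> = (\<Sum>k\<le>length u. Rep_ell2 ?f (take k u) * Rep_ell2 (scale_ell2 c x + y) (drop k u))"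
        unfolding sum_distrib_left sum.distrib[symmetric]
        by (rule sum.cong[OF refl]) (simp add: distrib_left mult.left_commute)
      finally show ?case .
    qed
  qed
  then show ?thesis unfolding left_convolution_def using X by blast
qed

lemma has_sum_finite_sum:
  fixes g :: "'b \<Rightarrow> 'a \<Rightarrow> real"
  assumes "finite B" "\<And>b. b \<in> B \<Longrightarrow> (g b has_sum s b) A"
  shows "((\<lambda>w. \<Sum>b\<in>B. g b w) has_sum (\<Sum>b\<in>B. s b)) A"
  using assms by (induction B rule: finite_induct) (auto intro: has_sum_add)

text \<open>Each word lies in exactly \<open>m\<close> windows; averaging the compressions of \<open>X\<close> to the windows
  gives the Cesaro means of \<open>X\<close> without any growth of the norm.\<close>

definition window :: "nat \<Rightarrow> nat \<Rightarrow> 'n list set" where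
  "window m b = {w. length w \<le> b \<and> b < length w + m}"

lemma sum_norm_window:
  "(\<Sum>b<N. (norm (truncate_ell2 (window m b) x))\<^sup>2) \<le> real m * (norm x)\<^sup>2"
proof -
  let ?g = "\<lambda>b w. (cmod (Rep_ell2 (truncate_ell2 (window m b) x) w))\<^sup>2"
  have "((\<lambda>w. \<Sum>b<N. ?g b w) has_sum (\<Sum>b<N. (norm (truncate_ell2 (window m b) x))\<^sup>2)) UNIV"
    by (rule has_sum_finite_sum) (auto simp: norm_ell2_power2 simp del: truncate_ell2.rep_eq)
  then show ?thesis
  proof (rule has_sum_le_finite_sums)
    fix F :: "'a list set" assume F: "finite F" "F \<subseteq> UNIV"
    have "(\<Sum>b<N. ?g b w) \<le> real m * (cmod (Rep_ell2 x w))\<^sup>2" for w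
    proof -
      have "(\<Sum>b<N. ?g b w) = (\<Sum>b\<in>{b. b < N \<and> w \<in> window m b}. (cmod (Rep_ell2 x w))\<^sup>2)"
        by (rule sum.mono_neutral_cong_right) auto
      also have "\<dots> \<le> real (card {length w..<length w + m}) * (cmod (Rep_ell2 x w))\<^sup>2"
        unfolding sum_constant
        by (intro mult_right_mono of_nat_mono card_mono) (auto simp: window_def)
      finally show ?thesis by simp
    qed
    then have "(\<Sum>w\<in>F. \<Sum>b<N. ?g b w) \<le> (\<Sum>w\<in>F. real m * (cmod (Rep_ell2 x w))\<^sup>2)"
      by (rule sum_mono)
    also have "\<dots> \<le> real m * (norm x)\<^sup>2"
      unfolding sum_distrib_left[symmetric]
      by (intro mult_left_mono sum_Rep_ell2_le_norm F) auto
    finally show "(\<Sum>w\<in>F. \<Sum>b<N. ?g b w) \<le> real m * (norm x)\<^sup>2" .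
  qed
qed

lemma Rep_left_word:
  "Rep_ell2 (left_word v x) u = (if take (length v) u = v then Rep_ell2 x (drop (length v) u) else 0)"
proof (induction v arbitrary: u)
  case (Cons i v)
  then show ?case by (cases u) auto
qed simp

lemma creation_algebra_left_word: "left_word v \<in> creation_algebra"
proof (induction v)
  case Nil
  have "left_word [] = (id :: 'a list operator)" by (auto simp: left_word_def)
  then show ?case by (simp add: generated_algebra.one)
next
  case (Cons i v)
  have "left_word (i # v) = left_creation i \<circ> left_word v" by (auto simp: left_word_def)
  then show ?case
    by (simp only:) (intro generated_algebra.mult generated_algebra.generator Cons rangeI)
qed

lemma creation_algebra_sum:
  assumes "finite S"
  shows "(\<lambda>x. \<Sum>v\<in>S. scale_ell2 (c v) (left_word v x)) \<in> creation_algebra"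
  using assms
proof (induction S rule: finite_induct)
  case empty
  have "(\<lambda>x. \<Sum>v\<in>{}. scale_ell2 (c v) (left_word v x)) = op_scale 0 id"
    by (simp add: op_scale_def)
  then show ?case by (simp only:) (intro generated_algebra.scale generated_algebra.one)
next
  case (insert v S)
  have "(\<lambda>x. \<Sum>v\<in>insert v S. scale_ell2 (c v) (left_word v x)) =
      op_add (op_scale (c v) (left_word v)) (\<lambda>x. \<Sum>v\<in>S. scale_ell2 (c v) (left_word v x))"
    using insert.hyps by (simp add: op_add_def op_scale_def)
  then show ?case
    by (simp only:)
      (intro generated_algebra.add generated_algebra.scale creation_algebra_left_word insert.IH)
qed

lemma finite_words_less: "finite {v :: 'n::finite list. length v < m}"
  using finite_lists_length_le[of "UNIV :: 'n set" m] by (auto elim: finite_subset[rotated])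

definition cesaro :: "'n::finite list ell2 \<Rightarrow> nat \<Rightarrow> 'n list operator" where
  "cesaro f m x = (\<Sum>v\<in>{v. length v < m}.
     scale_ell2 (of_real (real (m - length v) / real m) * Rep_ell2 f v) (left_word v x))"

lemma cesaro_in_creation_algebra: "cesaro f m \<in> creation_algebra"
  using creation_algebra_sum[OF finite_words_less] unfolding cesaro_def[abs_def] .

text \<open>Only prefixes of \<open>u\<close> contribute. For \<open>k \<ge> m\<close> the truncated
  subtraction makes the weight 0, so the range of summation need not depend on
  \<open>m\<close>.\<close>

lemma Rep_cesaro:
  "Rep_ell2 (cesaro f m x) u =
    (\<Sum>k\<le>length u. of_real (real (m - k) / real m) * (Rep_ell2 f (take k u) * Rep_ell2 x (drop k u)))"
proof -
  let ?t = "\<lambda>v. of_real (real (m - length v) / real m) * Rep_ell2 f v * Rep_ell2 (left_word v x) u"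
  have "Rep_ell2 (cesaro f m x) u = sum ?t {v. length v < m}"
    by (simp add: cesaro_def)
  also have "\<dots> = sum ?t ((\<lambda>k. take k u) ` {k. k \<le> length u \<and> k < m})"
  proof (rule sum.mono_neutral_right[OF finite_words_less])
    show "\<forall>v\<in>{v. length v < m} - (\<lambda>k. take k u) ` {k. k \<le> length u \<and> k < m}. ?t v = 0"
    proof
      fix v assume v: "v \<in> {v. length v < m} - (\<lambda>k. take k u) ` {k. k \<le> length u \<and> k < m}"
      have "take (length v) u \<noteq> v"
      proof
        assume a: "take (length v) u = v"
        then have "length v \<le> length u" by (metis length_take min.cobounded1)
        then have "take (length v) u \<in> (\<lambda>k. take k u) ` {k. k \<le> length u \<and> k < m}"
          using v by (intro imageI) auto
        then show False using v a by simp
      qed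
      then show "?t v = 0" by (simp add: Rep_left_word)
    qed
  qed auto
  also have "\<dots> = (\<Sum>k\<in>{k. k \<le> length u \<and> k < m}. ?t (take k u))"
    by (subst sum.reindex) (auto simp: inj_on_def dest: arg_cong[of _ _ length])
  also have "\<dots> = (\<Sum>k\<le>length u. of_real (real (m - k) / real m) * (Rep_ell2 f (take k u) * Rep_ell2 x (drop k u)))"
    by (rule sum.mono_neutral_cong_left) (auto simp: Rep_left_word min_def)
  finally show ?thesis .
qed

text \<open>The coordinate at \<open>u\<close> is the mean of the coordinates of
  \<open>X (P b)\<close> over \<open>m\<close> consecutive windows. Cauchy-Schwarz costs a factor
  \<open>m\<close>, the overlap of the windows costs another, and the square of the averaging factor
  \<open>1/m\<close> cancels both.\<close>

lemma norm_cesaro_le: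
  fixes X :: "'n::finite list operator"
  assumes X: "left_convolution X f" and K: "\<And>x. norm (X x) \<le> K * norm x" and "m > 0"
  shows "(norm (cesaro f m x))\<^sup>2 \<le> (K * norm x)\<^sup>2"
proof (rule norm_ell2_power2_le)
  fix F :: "'n list set" assume F: "finite F"
  define P where "P b = truncate_ell2 (window m b) x" for b
  \<comment> \<open>Exceeds every window index that occurs for some \<open>u\<close> in
    \<open>F\<close>, giving a common range of summation.\<close>
  define N where "N = (\<Sum>u\<in>F. length u + m)"
  have N: "length u + m \<le> N" if "u \<in> F" for u
    unfolding N_def using that F by (intro member_le_sum[of u F "\<lambda>u. length u + m"]) auto
  \<comment> \<open>For \<open>length u \<le> b < length u + m\<close>, the suffix
    \<open>drop k u\<close> belongs to the window \<open>b\<close> exactly when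
    \<open>b < length u - k + m\<close>. This holds for \<open>m - k\<close> values of
    \<open>b\<close>, which is the Fejer weight.\<close>
  have coef: "of_nat m * Rep_ell2 (cesaro f m x) u = (\<Sum>b\<in>{length u..<length u + m}. Rep_ell2 (X (P b)) u)" for u
  proof -
    have "(\<Sum>b\<in>{length u..<length u + m}. Rep_ell2 (X (P b)) u) =
      (\<Sum>b\<in>{length u..<length u + m}. \<Sum>k\<le>length u.
         if b < length u - k + m then Rep_ell2 f (take k u) * Rep_ell2 x (drop k u) else 0)"
      using X by (auto simp: left_convolution_def P_def window_def intro!: sum.cong)
    also have "\<dots> = (\<Sum>k\<le>length u. \<Sum>b\<in>{length u..<length u + m}.
         if b < length u - k + m then Rep_ell2 f (take k u) * Rep_ell2 x (drop k u) else 0)"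
      by (rule sum.swap)
    also have "\<dots> = (\<Sum>k\<le>length u. of_nat (m - k) * (Rep_ell2 f (take k u) * Rep_ell2 x (drop k u)))"
    proof (rule sum.cong[OF refl])
      fix k assume k: "k \<in> {..length u}"
      let ?c = "Rep_ell2 f (take k u) * Rep_ell2 x (drop k u)"
      have "(\<Sum>b\<in>{length u..<length u + m}. if b < length u - k + m then ?c else 0) =
          (\<Sum>b\<in>{length u..<length u - k + m}. ?c)"
        using k by (intro sum.mono_neutral_cong_right) auto
      then show "(\<Sum>b\<in>{length u..<length u + m}. if b < length u - k + m then ?c else 0) = of_nat (m - k) * ?c"
        using k by simp
    qed
    finally show ?thesis
      using \<open>m > 0\<close> by (simp add: Rep_cesaro sum_distrib_left)
  qed
  have pt: "real m * (cmod (Rep_ell2 (cesaro f m x) u))\<^sup>2 \<le> (\<Sum>b<N. (cmod (Rep_ell2 (X (P b)) u))\<^sup>2)"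
    if "u \<in> F" for u
  proof -
    have "real m * (real m * (cmod (Rep_ell2 (cesaro f m x) u))\<^sup>2) =
        (cmod (of_nat m * Rep_ell2 (cesaro f m x) u))\<^sup>2"
      by (simp add: norm_mult power_mult_distrib power2_eq_square)
    also have "\<dots> \<le> (\<Sum>b\<in>{length u..<length u + m}. cmod (Rep_ell2 (X (P b)) u))\<^sup>2"
      unfolding coef by (intro power_mono norm_sum) auto
    also have "\<dots> \<le> (\<Sum>b\<in>{length u..<length u + m}. (cmod (Rep_ell2 (X (P b)) u))\<^sup>2) * m"
      using sum_squared_le_sum_of_squares[of "\<lambda>b. cmod (Rep_ell2 (X (P b)) u)" "{length u..<length u + m}"]
      by simp
    also have "\<dots> \<le> (\<Sum>b<N. (cmod (Rep_ell2 (X (P b)) u))\<^sup>2) * m"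
      using N[OF that] by (intro mult_right_mono sum_mono2) auto
    finally show ?thesis using \<open>m > 0\<close> by (simp add: mult.commute)
  qed
  have "real m * (\<Sum>u\<in>F. (cmod (Rep_ell2 (cesaro f m x) u))\<^sup>2) \<le>
      (\<Sum>u\<in>F. \<Sum>b<N. (cmod (Rep_ell2 (X (P b)) u))\<^sup>2)"
    unfolding sum_distrib_left by (rule sum_mono) (rule pt)
  also have "\<dots> = (\<Sum>b<N. \<Sum>u\<in>F. (cmod (Rep_ell2 (X (P b)) u))\<^sup>2)"
    by (rule sum.swap)
  also have "\<dots> \<le> (\<Sum>b<N. (K * norm (P b))\<^sup>2)"
    by (intro sum_mono order_trans[OF sum_Rep_ell2_le_norm[OF F]] power_mono K) auto
  also have "\<dots> = K\<^sup>2 * (\<Sum>b<N. (norm (P b))\<^sup>2)"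
    by (simp add: power_mult_distrib sum_distrib_left)
  also have "\<dots> \<le> K\<^sup>2 * (real m * (norm x)\<^sup>2)"
    unfolding P_def by (intro mult_left_mono sum_norm_window) auto
  finally show "(\<Sum>u\<in>F. (cmod (Rep_ell2 (cesaro f m x) u))\<^sup>2) \<le> (K * norm x)\<^sup>2"
    using \<open>m > 0\<close> by (simp add: power_mult_distrib mult.left_commute)
qed

text \<open>A weak operator neighbourhood is the preimage of an open set in a product of copies of
  the complex plane, where convergence is convergence of each coefficient.\<close>

lemma free_semigroup_algebra_limit:
  assumes X: "X \<in> bounded_operators" and T: "\<And>m::nat. T m \<in> creation_algebra"
    and lim: "\<And>x y. (\<lambda>m. cinner_ell2 (T m x) y) \<longlonglongrightarrow> cinner_ell2 (X x) y"
  shows "X \<in> free_semigroup_algebra"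
  unfolding free_semigroup_algebra_def in_closure_of
proof (intro conjI allI impI)
  show "X \<in> topspace wot" using X by (simp add: topspace_wot)
  fix U assume U: "X \<in> U \<and> openin wot U"
  define g :: "'a list operator \<Rightarrow> _" where "g = (\<lambda>T (x, y). cinner_ell2 (T x) y)"
  obtain V where V: "open V" "U = g -` V \<inter> bounded_operators"
    using U unfolding wot_def openin_pullback_topology g_def by auto
  have "limitin (product_topology (\<lambda>_. euclidean) UNIV) (\<lambda>m. g (T m)) (g X) sequentially"
    unfolding limitin_componentwise using lim by (auto simp: g_def)
  then have "(\<lambda>m. g (T m)) \<longlonglongrightarrow> g X"
    by (simp add: euclidean_product_topology)
  moreover have "g X \<in> V" using U V(2) by auto
  ultimately have "eventually (\<lambda>m. g (T m) \<in> V) sequentially"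
    using topological_tendstoD[OF _ V(1)] by blast
  then obtain m where "g (T m) \<in> V"
    using eventually_happens'[OF sequentially_bot] by blast
  then show "\<exists>Y. Y \<in> creation_algebra \<and> Y \<in> U"
    using T[of m] creation_algebra_bounded[OF T[of m]] V(2) by blast
qed

text \<open>Each coordinate of the Fejer means is a finite sum with weights tending to 1. The
  uniform bound of \<open>norm_cesaro_le\<close> allows \<open>y\<close> to be replaced by a finite
  truncation, up to \<open>e / 3\<close> on either side.\<close>

lemma left_convolution_in_free_semigroup_algebra:
  fixes X :: "'n::finite list operator"
  assumes X: "left_convolution X f"
  shows "X \<in> free_semigroup_algebra"
proof (rule free_semigroup_algebra_limit)
  show bX: "X \<in> bounded_operators" using X by (simp add: left_convolution_def)
  show "cesaro f (Suc m) \<in> creation_algebra" for m by (rule cesaro_in_creation_algebra)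
  fix x y
  obtain K where K: "K > 0" "\<And>x. norm (X x) \<le> K * norm x"
    using bounded_linear.pos_bounded[OF bounded_operators_linear(5)[OF bX]] by (auto simp: mult.commute)
  have bound: "norm (cesaro f (Suc m) x) \<le> K * norm x" for m
    using norm_cesaro_le[OF X K(2), of "Suc m" x] K(1) by (auto intro: power2_le_imp_le)
  have c1: "(\<lambda>m. real (Suc m - k) / real (Suc m)) \<longlonglongrightarrow> 1" for k
  proof -
    have "(\<lambda>m. 1 - real k * inverse (real (Suc m))) \<longlonglongrightarrow> 1 - real k * 0"
      by (intro tendsto_intros LIMSEQ_inverse_real_of_nat)
    moreover have "eventually (\<lambda>m. 1 - real k * inverse (real (Suc m)) = real (Suc m - k) / real (Suc m)) sequentially"
      using eventually_ge_at_top[of k]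
      by eventually_elim (auto simp: field_simps of_nat_diff)
    ultimately show ?thesis by (simp add: tendsto_cong)
  qed
  have coef: "(\<lambda>m. Rep_ell2 (cesaro f (Suc m) x) u) \<longlonglongrightarrow> Rep_ell2 (X x) u" for u
  proof -
    have "(\<lambda>m. \<Sum>k\<le>length u. of_real (real (Suc m - k) / real (Suc m)) *
          (Rep_ell2 f (take k u) * Rep_ell2 x (drop k u)))
        \<longlonglongrightarrow> (\<Sum>k\<le>length u. of_real 1 * (Rep_ell2 f (take k u) * Rep_ell2 x (drop k u)))"
      by (intro tendsto_sum tendsto_mult tendsto_of_real c1 tendsto_const)
    then show ?thesis using X by (simp add: Rep_cesaro left_convolution_def del: of_real_divide)
  qed
  show "(\<lambda>m. cinner_ell2 (cesaro f (Suc m) x) y) \<longlonglongrightarrow> cinner_ell2 (X x) y"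
    unfolding tendsto_iff
  proof (intro allI impI)
    fix e :: real assume e: "e > 0"
    \<comment> \<open>The added 1 keeps the divisor positive when \<open>x = 0\<close>.\<close>
    define C where "C = K * norm x + 1"
    have C: "C > 0" "K * norm x < C" using K(1) by (auto simp: C_def intro: add_nonneg_pos)
    obtain F where F: "finite F" "norm (y - truncate_ell2 F y) < e / (3 * C)"
      using truncate_ell2_approx[of "e / (3 * C)" y] e C(1) by (metis divide_pos_pos mult_pos_pos order_refl zero_less_numeral)
    define z where "z = truncate_ell2 F y"
    have z: "cinner_ell2 w z = (\<Sum>u\<in>F. cnj (Rep_ell2 y u) * Rep_ell2 w u)" for w
      unfolding z_def truncate_ell2_finite[OF F(1)]
      by (simp add: cinner_ell2_sum_right cinner_ell2_scale_right)
    have "(\<lambda>m. cinner_ell2 (cesaro f (Suc m) x) z) \<longlonglongrightarrow> cinner_ell2 (X x) z"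
      unfolding z by (intro tendsto_sum tendsto_mult tendsto_const coef)
    then have "eventually (\<lambda>m. dist (cinner_ell2 (cesaro f (Suc m) x) z) (cinner_ell2 (X x) z) < e / 3) sequentially"
      by (rule tendstoD) (use e in simp)
    then show "eventually (\<lambda>m. dist (cinner_ell2 (cesaro f (Suc m) x) y) (cinner_ell2 (X x) y) < e) sequentially"
    proof eventually_elim
      case (elim m)
      have err: "cmod (cinner_ell2 w y - cinner_ell2 w z) \<le> e / 3" if "norm w \<le> K * norm x" for w
      proof -
        have "cinner_ell2 w y - cinner_ell2 w z = cinner_ell2 w (y - z)"
          using cinner_ell2_add_right[of w "y - z" z] by simp
        then have "cmod (cinner_ell2 w y - cinner_ell2 w z) \<le> norm w * norm (y - z)"
          by (simp add: cmod_cinner_ell2_le)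
        also have "\<dots> \<le> C * (e / (3 * C))"
          using that C F(2) e by (intro mult_mono) (auto simp: z_def)
        finally show ?thesis using C(1) by simp
      qed
      have "dist (cinner_ell2 (cesaro f (Suc m) x) y) (cinner_ell2 (X x) y) \<le>
         cmod (cinner_ell2 (cesaro f (Suc m) x) y - cinner_ell2 (cesaro f (Suc m) x) z) +
         dist (cinner_ell2 (cesaro f (Suc m) x) z) (cinner_ell2 (X x) z) +
         cmod (cinner_ell2 (X x) y - cinner_ell2 (X x) z)"
        unfolding dist_norm by norm
      also have "\<dots> < e" using err[OF bound[of m]] err[OF K(2)[of x]] elim by simp
      finally show ?case .
    qed
  qed
qed

text \<open>The commutant description makes closure under products immediate, although
  multiplication is not jointly continuous in the weak operator topology.\<close>

lemma free_semigroup_algebra_iff: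
  fixes X :: "'n::finite list operator"
  shows "X \<in> free_semigroup_algebra \<longleftrightarrow>
    X \<in> bounded_operators \<and> (\<forall>i x. X (right_creation i x) = right_creation i (X x))"
proof
  assume "X \<in> free_semigroup_algebra"
  then show "X \<in> bounded_operators \<and> (\<forall>i x. X (right_creation i x) = right_creation i (X x))"
    by (simp add: free_semigroup_algebra_bounded free_semigroup_algebra_commute)
next
  assume "X \<in> bounded_operators \<and> (\<forall>i x. X (right_creation i x) = right_creation i (X x))"
  then have "left_convolution X (X (basis_ell2 []))"
    by (intro right_commutant_left_convolution) auto
  then show "X \<in> free_semigroup_algebra"
    by (rule left_convolution_in_free_semigroup_algebra)
qed

lemma free_semigroup_algebra_closed:
  fixes X Y :: "'n::finite list operator"
  assumes "X \<in> free_semigroup_algebra" "Y \<in> free_semigroup_algebra"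
  shows "op_add X Y \<in> free_semigroup_algebra" "X \<circ> Y \<in> free_semigroup_algebra"
    "op_scale c X \<in> free_semigroup_algebra"
  using assms unfolding free_semigroup_algebra_iff
  by (simp_all add: bounded_operators_op_add bounded_operators_comp bounded_operators_op_scale)
    (simp_all add: op_add_def op_scale_def right_creation_linear)

section \<open>The homomorphisms\<close>

definition right_word :: "'n list \<Rightarrow> 'n list operator" where
  "right_word w x = flip_ell2 (left_word (rev w) (flip_ell2 x))"

text \<open>If \<open>u\<close> is shorter than \<open>w\<close>, the truncated difference is 0 and
  the comparison of \<open>u\<close> with \<open>w\<close> fails by length.\<close>

lemma Rep_right_word:
  "Rep_ell2 (right_word w x) u =
    (if drop (length u - length w) u = w then Rep_ell2 x (take (length u - length w) u) else 0)"
  by (simp add: right_word_def Rep_left_word take_rev drop_rev)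

lemma left_convolution_vacuum:
  assumes "left_convolution X f" shows "X (basis_ell2 []) = f"
proof (rule ell2_eqI)
  fix u
  have "Rep_ell2 (X (basis_ell2 [])) u = (\<Sum>k\<le>length u. Rep_ell2 f (take k u) * Rep_ell2 (basis_ell2 []) (drop k u))"
    using assms by (simp add: left_convolution_def)
  also have "\<dots> = (\<Sum>k\<in>{length u}. Rep_ell2 f (take k u))"
    by (rule sum.mono_neutral_cong_right) auto
  finally show "Rep_ell2 (X (basis_ell2 [])) u = Rep_ell2 f u" by simp
qed

text \<open>Read from the right factor, convolution is a combination of the vectors obtained by
  appending words to \<open>f\<close>; it is this form that uses orthonormality.\<close>

lemma convolution_truncate:
  assumes "finite F"
  shows "(\<Sum>k\<le>length u. Rep_ell2 f (take k u) * Rep_ell2 (truncate_ell2 F x) (drop k u)) =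
    Rep_ell2 (\<Sum>w\<in>F. scale_ell2 (Rep_ell2 x w) (right_word w f)) u"
proof -
  let ?t = "\<lambda>w. Rep_ell2 x w * Rep_ell2 (right_word w f) u"
  have inj: "inj_on (\<lambda>k. drop k u) {..length u}"
    by (auto simp: inj_on_def dest!: arg_cong[of _ _ length])
  have "(\<Sum>k\<le>length u. Rep_ell2 f (take k u) * Rep_ell2 (truncate_ell2 F x) (drop k u)) =
      (\<Sum>k\<in>{k. k \<le> length u \<and> drop k u \<in> F}. ?t (drop k u))"
    by (rule sum.mono_neutral_cong_right) (auto simp: Rep_right_word)
  also have "\<dots> = sum ?t ((\<lambda>k. drop k u) ` {k. k \<le> length u \<and> drop k u \<in> F})"
    by (rule sum.reindex_cong[symmetric, OF _ refl refl]) (rule inj_on_subset[OF inj], auto)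
  also have "\<dots> = sum ?t F"
  proof (rule sum.mono_neutral_left[OF assms])
    show "\<forall>w\<in>F - (\<lambda>k. drop k u) ` {k. k \<le> length u \<and> drop k u \<in> F}. ?t w = 0"
    proof
      fix w assume w: "w \<in> F - (\<lambda>k. drop k u) ` {k. k \<le> length u \<and> drop k u \<in> F}"
      have "drop (length u - length w) u \<noteq> w"
      proof
        assume "drop (length u - length w) u = w"
        then have "w \<in> (\<lambda>k. drop k u) ` {k. k \<le> length u \<and> drop k u \<in> F}"
          using w by (intro image_eqI[of _ _ "length u - length w"]) auto
        then show False using w by blast
      qed
      then show "?t w = 0" by (simp add: Rep_right_word)
    qed
  qed auto
  finally show ?thesis by simp
qed

lemma norm_sum_orthonormal:
  assumes "finite F" "\<And>u v. cinner_ell2 (r u) (r v) = (if u = v then 1 else 0)"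
  shows "norm (\<Sum>w\<in>F. scale_ell2 (Rep_ell2 x w) (r w)) = norm (truncate_ell2 F x)"
proof -
  have "cinner_ell2 (\<Sum>w\<in>F. scale_ell2 (Rep_ell2 x w) (r w)) (\<Sum>w\<in>F. scale_ell2 (Rep_ell2 x w) (r w)) =
      (\<Sum>w\<in>F. Rep_ell2 x w * cnj (Rep_ell2 x w))"
    using assms by (simp add: cinner_ell2_sum_left cinner_ell2_sum_right cinner_ell2_scale_left
        cinner_ell2_scale_right if_distrib[of "\<lambda>c. _ * c"] mult.commute cong: if_cong)
  also have "\<dots> = cinner_ell2 (truncate_ell2 F x) (truncate_ell2 F x)"
    unfolding truncate_ell2_finite[OF assms(1)]
    using assms(1) by (simp add: cinner_ell2_sum_left cinner_ell2_sum_right cinner_ell2_scale_left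
        cinner_ell2_scale_right if_distrib[of "\<lambda>c. _ * c"] mult.commute cong: if_cong)
  finally show ?thesis by (simp add: cinner_ell2_self power2_eq_iff_nonneg del: of_real_power)
qed

lemma span_basis_finite_support:
  assumes "x \<in> ell2.span (range basis_ell2)"
  obtains F where "finite F" "truncate_ell2 F x = x"
proof -
  have "\<exists>F. finite F \<and> (\<forall>w. w \<notin> F \<longrightarrow> Rep_ell2 x w = 0)"
    using assms
  proof (induction rule: ell2.span_induct_alt)
    case base
    then show ?case by auto
  next
    case (step c b y)
    then obtain F v where F: "finite F" "\<forall>w. w \<notin> F \<longrightarrow> Rep_ell2 y w = 0" "b = basis_ell2 v" by auto
    then show ?case by (intro exI[of _ "insert v F"]) auto
  qed
  then obtain F where "finite F" "\<And>w. w \<notin> F \<Longrightarrow> Rep_ell2 x w = 0" by blast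
  then have "truncate_ell2 F x = x" by (intro ell2_eqI) auto
  with \<open>finite F\<close> show thesis by (rule that)
qed

text \<open>On finitely supported vectors convolution by \<open>f\<close> sends the standard basis
  to an orthonormal system. The same computation bounds partial sums of squares for arbitrary
  \<open>x\<close>, which makes the operator well defined and contractive; equality of norms extends
  by density.\<close>

lemma left_convolution_isometry_exists:
  assumes orth: "\<And>u v. cinner_ell2 (right_word u f) (right_word v f) = (if u = v then 1 else 0)"
  obtains X where "left_convolution X f" "isometry X"
proof -
  define c where "c x u = (\<Sum>k\<le>length u. Rep_ell2 f (take k u) * Rep_ell2 x (drop k u))" for x u
  have bound: "(\<Sum>u\<in>G. (cmod (c x u))\<^sup>2) \<le> (norm x)\<^sup>2" if G: "finite G" for G x
  proof -
    \<comment> \<open>Coordinates at words of \<open>G\<close> depend only on the values of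
      \<open>x\<close> at suffixes of these words.\<close>
    define F where "F = (\<Union>u\<in>G. (\<lambda>k. drop k u) ` {..length u})"
    have F: "finite F" using G by (simp add: F_def)
    define z where "z = (\<Sum>w\<in>F. scale_ell2 (Rep_ell2 x w) (right_word w f))"
    have "c x u = Rep_ell2 z u" if "u \<in> G" for u
      unfolding c_def z_def convolution_truncate[OF F, symmetric]
      using that by (intro sum.cong refl) (auto simp: F_def)
    then have "(\<Sum>u\<in>G. (cmod (c x u))\<^sup>2) \<le> (norm z)\<^sup>2"
      using sum_Rep_ell2_le_norm[OF G, of z] by simp
    also have "\<dots> \<le> (norm x)\<^sup>2"
      unfolding z_def norm_sum_orthonormal[of F "\<lambda>w. right_word w f", OF F orth]
      using norm_truncate_ell2_Pythagoras[of x F] by simp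
    finally show ?thesis .
  qed
  define X where "X x = Abs_ell2 (c x)" for x
  have Rep: "Rep_ell2 (X x) u = c x u" for x u
    unfolding X_def
    by (subst Abs_ell2_inverse) (use ell2_membership_bounded[OF bound] in auto)
  have norm_X: "norm (X x) \<le> norm x" for x
    using norm_ell2_power2_le[of "X x" "(norm x)\<^sup>2"] bound
    by (auto simp: Rep intro: power2_le_imp_le)
  have bX: "bounded_linear X"
    by (rule bounded_linear_intro[where K = 1])
      (auto intro!: ell2_eqI simp: Rep c_def scaleR_ell2_def norm_X sum_distrib_left
         sum.distrib[symmetric] algebra_simps)
  have scale: "X (scale_ell2 a x) = scale_ell2 a (X x)" for a x
    by (rule ell2_eqI) (simp add: Rep c_def sum_distrib_left mult.left_commute)
  have "left_convolution X f"
    using bX scale by (simp add: left_convolution_def bounded_operators_def Rep c_def)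
  moreover have "isometry X"
    unfolding isometry_def
  proof
    fix x
    show "norm (X x) = norm x"
    proof (rule ell2_continuous_eq_on_basis[where x = x])
      show "continuous_on UNIV (\<lambda>x. norm (X x))"
        by (intro continuous_on_norm linear_continuous_on bX)
      show "norm (X x) = norm x" if x: "x \<in> ell2.span (range basis_ell2)" for x
      proof -
        obtain F where F: "finite F" "truncate_ell2 F x = x"
          using span_basis_finite_support[OF x] .
        have "X (truncate_ell2 F x) = (\<Sum>w\<in>F. scale_ell2 (Rep_ell2 x w) (right_word w f))"
          by (rule ell2_eqI) (simp only: Rep c_def convolution_truncate[OF F(1)])
        then show ?thesis
          using norm_sum_orthonormal[of F "\<lambda>w. right_word w f" x, OF F(1) orth] F(2) by simp
      qed
    qed (intro continuous_intros)
  qed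
  ultimately show thesis by (rule that)
qed

section \<open>Evaluation of square-summable series at a tuple\<close>

lemma eval_word_simps [simp]:
  "eval_word A [] = mat 1" "eval_word A (i # w) = A i ** eval_word A w"
  by (simp_all add: eval_word_def)

lemma eval_word_append: "eval_word A (u @ v) = eval_word A u ** eval_word A v"
  by (induction u) (auto simp: matrix_mul_assoc)

lemma eval_word_snoc: "eval_word A (u @ [i]) = eval_word A u ** A i"
  by (simp add: eval_word_append)

locale square_summable_tuple =
  fixes A :: "('n::finite, 'd::finite) tuple"
  assumes square_summable: "(\<lambda>w. (cmod (eval_word A w $ k $ l))\<^sup>2) summable_on UNIV"

lemma linear_matrix_vector_mult_complex: "linear (\<lambda>x :: complex ^ 'm. (B :: complex ^ 'm ^ 'k) *v x)"
  by (rule linearI)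
    (simp_all add: vec_eq_iff matrix_vector_mult_def scaleR_sum_right sum.distrib[symmetric] distrib_left)

lemma matrix_vector_mult_axis: "((B :: complex ^ 'm ^ 'k) *v axis l 1) $ k = B $ k $ l"
  by (simp add: matrix_vector_mult_def axis_def if_distrib[of "\<lambda>c. _ * c"] cong: if_cong)

text \<open>With \<open>r = row_norm A\<close>, the adjoints satisfy \<open>\<Sum>\<^sub>i \<parallel>A\<^sub>i\<^sup>* y\<parallel>\<^sup>2 \<le> r\<^sup>2 \<parallel>y\<parallel>\<^sup>2\<close>, and iterating over words
  gives a geometric series.\<close>

lemma row_norm_less_1_square_summable:
  fixes A :: "('n::finite, 'd::finite) tuple"
  assumes "row_norm A < 1"
  shows "square_summable_tuple A"
proof
  define T where "T = (\<lambda>v :: complex ^ 'd ^ 'n. \<Sum>i\<in>UNIV. A i *v (v $ i))"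
  define r where "r = row_norm A"
  have "linear T" unfolding T_def
    by (intro linear_compose_sum ballI linear_compose[unfolded o_def, OF _ linear_matrix_vector_mult_complex])
      (auto intro: linearI)
  then have T: "bounded_linear T" by (rule linear_conv_bounded_linear[THEN iffD1])
  have r: "0 \<le> r" "r < 1" "norm (T v) \<le> r * norm v" for v
    using assms onorm_pos_le[OF T] onorm[OF T] by (auto simp: r_def row_norm_def T_def)
  define B where "B i = adjoint (\<lambda>x. A i *v x)" for i
  have B: "x \<bullet> B i y = (A i *v x) \<bullet> y" for i x y
    unfolding B_def by (rule adjoint_works[OF linear_matrix_vector_mult_complex])
  have sumB: "(\<Sum>i\<in>UNIV. (norm (B i y))\<^sup>2) \<le> r\<^sup>2 * (norm y)\<^sup>2" for y
  proof -
    \<comment> \<open>This \<open>v\<close> is the adjoint of the row operator \<open>T\<close>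
      applied to \<open>y\<close>, so its squared norm is the inner product of \<open>T v\<close>
      with \<open>y\<close>.\<close>
    define v :: "complex ^ 'd ^ 'n" where "v = (\<chi> i. B i y)"
    have nv: "(norm v)\<^sup>2 = (\<Sum>i\<in>UNIV. (norm (B i y))\<^sup>2)"
      by (simp add: power2_norm_eq_inner inner_vec_def v_def)
    have "(norm v)\<^sup>2 = T v \<bullet> y"
      unfolding nv unfolding power2_norm_eq_inner B by (simp add: T_def inner_sum_left v_def)
    also have "\<dots> \<le> norm (T v) * norm y" by (rule norm_cauchy_schwarz)
    also have "\<dots> \<le> r * norm v * norm y" by (intro mult_right_mono r) auto
    finally have "norm v * norm v \<le> norm v * (r * norm y)"
      by (simp add: power2_eq_square mult.assoc mult.left_commute)
    then have "norm v \<le> r * norm y"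
      using r(1) by (cases "norm v = 0") (auto simp: mult_le_cancel_left)
    then have "(norm v)\<^sup>2 \<le> (r * norm y)\<^sup>2" by (intro power_mono) auto
    then show ?thesis by (simp add: nv power_mult_distrib)
  qed
  \<comment> \<open>\<open>b w\<close> is the adjoint of \<open>eval_word A w\<close>: adjoints
    reverse products, hence \<open>fold\<close> against the \<open>foldr\<close> of
    \<open>eval_word\<close>.\<close>
  define b where "b w y = fold B w y" for w y
  have b_simps: "b [] y = y" "b (i # w) y = b w (B i y)" for i w y by (simp_all add: b_def)
  have b_inner: "x \<bullet> b w y = (eval_word A w *v x) \<bullet> y" for x w y
    by (induction w arbitrary: y) (simp_all add: b_simps B matrix_vector_mul_assoc[symmetric])
  \<comment> \<open>The geometric series in \<open>r^2\<close>; as the solution of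
    \<open>1 + C r^2 = C\<close> it closes the induction on word length.\<close>
  define C where "C = 1 / (1 - r\<^sup>2)"
  have r2: "r\<^sup>2 < 1" using r by (simp add: power_less_one_iff)
  have C: "1 + C * r\<^sup>2 = C" "0 \<le> C" using r2 by (auto simp: C_def field_simps)
  have b_sum: "(\<Sum>w\<in>{w. length w < k}. (norm (b w y))\<^sup>2) \<le> C * (norm y)\<^sup>2" for k y
  proof (induction k arbitrary: y)
    case 0
    then show ?case using C by simp
  next
    case (Suc k)
    have eq: "{w :: 'n list. length w < Suc k} = insert [] ((\<lambda>(i, w). i # w) ` (UNIV \<times> {w. length w < k}))"
    proof (rule set_eqI)
      fix w :: "'n list"
      show "w \<in> {w. length w < Suc k} \<longleftrightarrow> w \<in> insert [] ((\<lambda>(i, w). i # w) ` (UNIV \<times> {w. length w < k}))"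
        by (cases w) auto
    qed
    have "(\<Sum>w\<in>{w. length w < Suc k}. (norm (b w y))\<^sup>2) =
        (norm y)\<^sup>2 + (\<Sum>p\<in>UNIV \<times> {w. length w < k}. (norm (b (fst p # snd p) y))\<^sup>2)"
      unfolding eq by (subst sum.insert) (auto simp: finite_words_less b_simps sum.reindex inj_on_def case_prod_beta)
    also have "\<dots> = (norm y)\<^sup>2 + (\<Sum>i\<in>UNIV. \<Sum>w\<in>{w. length w < k}. (norm (b w (B i y)))\<^sup>2)"
      by (simp add: sum.cartesian_product case_prod_beta b_simps)
    also have "\<dots> \<le> (norm y)\<^sup>2 + (\<Sum>i\<in>UNIV. C * (norm (B i y))\<^sup>2)"
      by (intro add_left_mono sum_mono Suc.IH)
    also have "\<dots> \<le> (norm y)\<^sup>2 + C * (r\<^sup>2 * (norm y)\<^sup>2)"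
      unfolding sum_distrib_left[symmetric] by (intro add_left_mono mult_left_mono sumB C)
    also have "\<dots> = (1 + C * r\<^sup>2) * (norm y)\<^sup>2" by (simp add: algebra_simps)
    finally show ?case by (simp only: C)
  qed
  show "(\<lambda>w. (cmod (eval_word A w $ k $ l))\<^sup>2) summable_on UNIV" for k l
  proof (rule ell2_membership_bounded)
    fix F :: "'n list set" assume F: "finite F"
    have entry: "z \<bullet> (eval_word A w $ k $ l) \<le> norm (b w (axis k z))" for z w
    proof -
      have "z \<bullet> (eval_word A w $ k $ l) = (eval_word A w *v axis l 1) \<bullet> axis k z"
        by (simp add: inner_axis matrix_vector_mult_axis inner_commute[of z])
      also have "\<dots> \<le> norm (axis l (1 :: complex)) * norm (b w (axis k z))"
        unfolding b_inner[symmetric] by (rule norm_cauchy_schwarz)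
      finally show ?thesis by simp
    qed
    define S where "S z = C * (norm (axis k z :: complex ^ 'd))\<^sup>2" for z
    \<comment> \<open>The adjoints refer to the real inner product. Testing against 1, -1, \<i> and
      -\<i> bounds the real and imaginary parts from both sides.\<close>
    have "(cmod (eval_word A w $ k $ l))\<^sup>2 \<le> 
        (norm (b w (axis k 1)))\<^sup>2 + (norm (b w (axis k (-1))))\<^sup>2 +
        ((norm (b w (axis k \<i>)))\<^sup>2 + (norm (b w (axis k (-\<i>))))\<^sup>2)" for w
    proof -
      let ?c = "eval_word A w $ k $ l"
      have abs: "t\<^sup>2 \<le> p\<^sup>2 + q\<^sup>2" if "t \<le> p" "- t \<le> q" "0 \<le> p" "0 \<le> q" for t p q :: real
      proof (cases "0 \<le> t")
        case True
        then have "t\<^sup>2 \<le> p\<^sup>2" using that by (intro power_mono)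
        then show ?thesis using zero_le_power2[of q] by linarith
      next
        case False
        then have "(- t)\<^sup>2 \<le> q\<^sup>2" using that by (intro power_mono) auto
        then show ?thesis using zero_le_power2[of p] power2_minus[of t] by linarith
      qed
      have "(Re ?c)\<^sup>2 \<le> (norm (b w (axis k 1)))\<^sup>2 + (norm (b w (axis k (-1))))\<^sup>2"
        using entry[of 1 w] entry[of "-1" w] by (intro abs) (auto simp: inner_complex_def)
      moreover have "(Im ?c)\<^sup>2 \<le> (norm (b w (axis k \<i>)))\<^sup>2 + (norm (b w (axis k (-\<i>))))\<^sup>2"
        using entry[of "\<i>" w] entry[of "-\<i>" w] by (intro abs) (auto simp: inner_complex_def)
      ultimately show ?thesis unfolding cmod_power2 by simp
    qed
    then have "(\<Sum>w\<in>F. (cmod (eval_word A w $ k $ l))\<^sup>2) \<le>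
        (\<Sum>w\<in>F. (norm (b w (axis k 1)))\<^sup>2) + (\<Sum>w\<in>F. (norm (b w (axis k (-1))))\<^sup>2) +
        ((\<Sum>w\<in>F. (norm (b w (axis k \<i>)))\<^sup>2) + (\<Sum>w\<in>F. (norm (b w (axis k (-\<i>))))\<^sup>2))"
      unfolding sum.distrib[symmetric] by (rule sum_mono)
    also have "\<dots> \<le> S 1 + S (-1) + (S \<i> + S (-\<i>))"
    proof -
      define N where "N = Suc (\<Sum>u\<in>F. length u)"
      have N: "length u < N" if "u \<in> F" for u
        unfolding N_def less_Suc_eq_le using that F by (intro member_le_sum[of u F length]) auto
      have "(\<Sum>w\<in>F. (norm (b w (axis k z)))\<^sup>2) \<le> S z" for z
      proof -
        have "(\<Sum>w\<in>F. (norm (b w (axis k z)))\<^sup>2) \<le> (\<Sum>w\<in>{w. length w < N}. (norm (b w (axis k z)))\<^sup>2)"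
          using N by (intro sum_mono2 finite_words_less) auto
        also have "\<dots> \<le> S z" unfolding S_def by (rule b_sum)
        finally show ?thesis .
      qed
      then show ?thesis by (intro add_mono)
    qed
    finally show "(\<Sum>w\<in>F. (cmod (eval_word A w $ k $ l))\<^sup>2) \<le> S 1 + S (-1) + (S \<i> + S (-\<i>))" .
  qed
qed

text \<open>Represents the functional taking \<open>x\<close> to the \<open>(k, l)\<close> entry of
  the series \<Sum> \<open>x_w A_w\<close>; the conjugate offsets the antilinearity of the second
  argument. \<open>Abs_ell2\<close> is meaningful here only for square-summable entries.\<close>

definition word_vector :: "('n::finite, 'd::finite) tuple \<Rightarrow> 'd \<Rightarrow> 'd \<Rightarrow> 'n list ell2" where
  "word_vector A k l = Abs_ell2 (\<lambda>w. cnj (eval_word A w $ k $ l))"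

text \<open>The homomorphism \<open>\<Phi>\<^sub>A\<close> sees an operator \<open>X\<close> only through the vector \<open>X \<xi>\<close>, where \<open>\<xi>\<close> is the
  basis vector of the empty word.\<close>

definition vector_eval :: "('n::finite, 'd::finite) tuple \<Rightarrow> 'n list ell2 \<Rightarrow> complex ^ 'd ^ 'd" where
  "vector_eval A x = (\<chi> k l. cinner_ell2 x (word_vector A k l))"

lemma vector_eval_add: "vector_eval A (x + y) = vector_eval A x + vector_eval A y"
  and vector_eval_scale: "vector_eval A (scale_ell2 c x) = mat_scale c (vector_eval A x)"
  and vector_eval_zero [simp]: "vector_eval A 0 = 0"
  by (simp_all add: vector_eval_def vec_eq_iff cinner_ell2_add_left cinner_ell2_scale_left mat_scale_def
      map_matrix_def)

lemma vector_eval_diff: "vector_eval A (x - y) = vector_eval A x - vector_eval A y"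
  by (simp add: vector_eval_def vec_eq_iff cinner_ell2_diff_left)

lemma vector_eval_sum: "vector_eval A (\<Sum>i\<in>I. f i) = (\<Sum>i\<in>I. vector_eval A (f i))"
  by (induction I rule: infinite_finite_induct) (simp_all add: vector_eval_add)

context square_summable_tuple
begin

lemma Rep_word_vector: "Rep_ell2 (word_vector A k l) w = cnj (eval_word A w $ k $ l)"
  unfolding word_vector_def by (subst Abs_ell2_inverse) (simp_all add: square_summable)

lemma vector_eval_basis: "vector_eval A (basis_ell2 w) = eval_word A w"
  by (simp add: vector_eval_def vec_eq_iff Rep_word_vector)

lemma vector_eval_left_creation: "vector_eval A (left_creation i x) = A i ** vector_eval A x"
proof -
  have "left_annihilation i (word_vector A k l) =
      (\<Sum>m\<in>UNIV. scale_ell2 (cnj (A i $ k $ m)) (word_vector A m l))" for k l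
    by (rule ell2_eqI) (simp add: Rep_word_vector matrix_matrix_mult_def)
  then show ?thesis
    by (simp add: vector_eval_def vec_eq_iff cinner_left_creation_left matrix_matrix_mult_def
        cinner_ell2_sum_right cinner_ell2_scale_right)
qed

text \<open>The right-hand counterpart of \<open>vector_eval_left_creation\<close>, from
  \<open>A_{wi} = A_w A_i\<close>; together they make the kernel invariant on both sides.\<close>

lemma vector_eval_flip_left_creation:
  "vector_eval A (flip_ell2 (left_creation i x)) = vector_eval A (flip_ell2 x) ** A i"
proof -
  have "left_annihilation i (flip_ell2 (word_vector A k l)) =
      (\<Sum>m\<in>UNIV. scale_ell2 (cnj (A i $ m $ l)) (flip_ell2 (word_vector A k m)))" for k l
    by (rule ell2_eqI) (simp add: Rep_word_vector eval_word_snoc matrix_matrix_mult_def mult.commute)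
  then show ?thesis
    by (simp add: vector_eval_def vec_eq_iff cinner_left_creation_left matrix_matrix_mult_def
        cinner_ell2_sum_right cinner_ell2_scale_right cinner_flip_left mult.commute)
qed

text \<open>For fixed \<open>x\<close> every entry of either side is a finite combination of matrix
  coefficients of \<open>X\<close>, so induction over the generated algebra suffices. This yields
  both multiplicativity of the representation and invariance of the kernel.\<close>

lemma vector_eval_FSA:
  assumes X: "X \<in> free_semigroup_algebra"
  shows "vector_eval A (X x) = vector_eval A (X (basis_ell2 [])) ** vector_eval A x"
proof -
  have alg: "vector_eval A (Y x) = vector_eval A (Y (basis_ell2 [])) ** vector_eval A x"
    if "Y \<in> creation_algebra" for Y x
    using that
  proof (induction arbitrary: x rule: generated_algebra.induct)
    case (generator Y)
    then show ?case by (auto simp: vector_eval_left_creation vector_eval_basis)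
  next
    case one
    then show ?case by (simp add: vector_eval_basis)
  next
    case (add Y Z)
    show ?case
      by (simp only: op_add_def vector_eval_add add.IH(1)[of x] add.IH(2)[of x])
        (simp add: matrix_matrix_mult_def vec_eq_iff distrib_right sum.distrib)
  next
    case (mult Y Z)
    have "vector_eval A ((Y \<circ> Z) x) =
        vector_eval A (Y (basis_ell2 [])) ** (vector_eval A (Z (basis_ell2 [])) ** vector_eval A x)"
      by (simp only: o_apply mult.IH(1)[of "Z x"] mult.IH(2)[of x])
    also have "\<dots> = vector_eval A (Y (Z (basis_ell2 []))) ** vector_eval A x"
      by (simp only: matrix_mul_assoc mult.IH(1)[of "Z (basis_ell2 [])"])
    finally show ?case by (simp only: o_apply)
  next
    case (scale Y c)
    show ?case using scale.IH[of x]
      by (simp add: op_scale_def vector_eval_scale mat_scale_def matrix_matrix_mult_def map_matrix_def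
          vec_eq_iff sum_distrib_left mult.assoc)
  qed
  have "vector_eval A (X x) $ k $ l = (vector_eval A (X (basis_ell2 [])) ** vector_eval A x) $ k $ l" for k l
  proof (rule free_semigroup_algebra_functional_eq[OF X])
    show "continuous_map wot euclidean (\<lambda>X. vector_eval A (X x) $ k $ l)"
      by (simp add: vector_eval_def continuous_map_wot_matrix_coefficient)
    have "continuous_map wot euclidean (\<lambda>X. \<Sum>m\<in>UNIV. cinner_ell2 (X (basis_ell2 [])) (word_vector A k m) * vector_eval A x $ m $ l)"
      using continuous_map_wotI[of "\<lambda>F. \<Sum>m\<in>UNIV. F (basis_ell2 [], word_vector A k m) * vector_eval A x $ m $ l"]
      by (simp add: continuous_on_product_coordinates continuous_intros)
    then show "continuous_map wot euclidean (\<lambda>X. (vector_eval A (X (basis_ell2 [])) ** vector_eval A x) $ k $ l)"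
      by (simp add: matrix_matrix_mult_def vector_eval_def[of A "_ (basis_ell2 [])"])
    show "vector_eval A (T x) $ k $ l = (vector_eval A (T (basis_ell2 [])) ** vector_eval A x) $ k $ l"
      if "T \<in> creation_algebra" for T
      by (simp only: alg[OF that, of x])
  qed
  then show ?thesis by (simp add: vec_eq_iff)
qed

lemma continuous_map_wot_vector_eval:
  "continuous_map wot euclidean (\<lambda>X. vector_eval A (X x))"
  using continuous_map_wotI[of "\<lambda>F. \<chi> k l. F (x, word_vector A k l)"]
  by (simp add: vector_eval_def continuous_on_vec_lambda continuous_on_product_coordinates)

lemma wot_representation_eq:
  assumes "is_wot_representation A \<Phi>" and X: "X \<in> free_semigroup_algebra"
  shows "\<Phi> X = vector_eval A (X (basis_ell2 []))"
proof -
  have rep: "\<Phi> id = mat 1"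
    "\<And>X Y. X \<in> free_semigroup_algebra \<Longrightarrow> Y \<in> free_semigroup_algebra \<Longrightarrow> \<Phi> (op_add X Y) = \<Phi> X + \<Phi> Y"
    "\<And>X Y. X \<in> free_semigroup_algebra \<Longrightarrow> Y \<in> free_semigroup_algebra \<Longrightarrow> \<Phi> (X \<circ> Y) = \<Phi> X ** \<Phi> Y"
    "\<And>X c. X \<in> free_semigroup_algebra \<Longrightarrow> \<Phi> (op_scale c X) = mat_scale c (\<Phi> X)"
    "\<And>i. \<Phi> (left_creation i) = A i"
    using assms(1) unfolding is_wot_representation_def by blast+
  let ?T = "subtopology wot (free_semigroup_algebra :: 'n list operator set)"
  show ?thesis
  proof (rule forall_in_closure_of_eq[where X = ?T and Y = euclidean and S = creation_algebra
        and f = \<Phi> and g = "\<lambda>X. vector_eval A (X (basis_ell2 []))"])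
  show "X \<in> ?T closure_of creation_algebra"
  proof -
    have "free_semigroup_algebra \<inter> creation_algebra = (creation_algebra :: 'n list operator set)"
      using creation_algebra_subset by (rule Int_absorb1)
    then have "?T closure_of creation_algebra = free_semigroup_algebra \<inter> wot closure_of creation_algebra"
      by (simp only: closure_of_subtopology)
    then show ?thesis using X by (simp add: free_semigroup_algebra_def)
  qed
  show "Hausdorff_space (euclidean :: (complex ^ 'd ^ 'd) topology)" by simp
  show "continuous_map ?T euclidean \<Phi>" using assms(1) by (simp add: is_wot_representation_def)
  show "continuous_map ?T euclidean (\<lambda>X. vector_eval A (X (basis_ell2 [])))"
    by (rule continuous_map_from_subtopology[OF continuous_map_wot_vector_eval])
  show "\<Phi> T = vector_eval A (T (basis_ell2 []))" if "T \<in> creation_algebra" for T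
    using that
  proof (induction rule: generated_algebra.induct)
    case (generator Y)
    then show ?case by (auto simp: rep vector_eval_left_creation vector_eval_basis)
  next
    case one
    then show ?case by (simp only: rep(1)) (simp only: id_apply vector_eval_basis eval_word_simps)
  next
    case (add Y Z)
    then show ?case
      by (simp only: rep(2) subsetD[OF creation_algebra_subset] op_add_def[of Y Z, symmetric])
        (simp only: op_add_def vector_eval_add)
  next
    case (mult Y Z)
    then have YZ: "Y \<in> free_semigroup_algebra" "Z \<in> free_semigroup_algebra"
      by (auto intro: subsetD[OF creation_algebra_subset])
    show ?case
      by (simp only: rep(3)[OF YZ] mult.IH) (simp only: o_apply vector_eval_FSA[OF YZ(1), of "Z (basis_ell2 [])"])
  next
    case (scale Y c)
    then show ?case
      by (simp only: rep(4) subsetD[OF creation_algebra_subset]) (simp only: op_scale_def vector_eval_scale)  qed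
  qed
qed

text \<open>Evaluation at the vacuum is a continuous representation, and
  \<open>wot_representation_eq\<close> shows that any other one agrees with it on the algebra; hence
  the definite description denotes it.\<close>

lemma Phi_eq:
  assumes X: "X \<in> free_semigroup_algebra"
  shows "Phi A X = vector_eval A (X (basis_ell2 []))"
proof -
  define \<Phi> where "\<Phi> = restrict (\<lambda>X. vector_eval A (X (basis_ell2 []))) free_semigroup_algebra"
  have id: "id \<in> (free_semigroup_algebra :: 'n list operator set)"
    by (rule subsetD[OF creation_algebra_subset generated_algebra.one])
  have gen: "left_creation i \<in> free_semigroup_algebra" for i :: 'n
    by (rule subsetD[OF creation_algebra_subset generated_algebra.generator[OF rangeI]])
  have "continuous_map (subtopology wot free_semigroup_algebra) euclidean \<Phi>"
    by (rule continuous_map_eq[OF continuous_map_from_subtopology[OF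
            continuous_map_wot_vector_eval[of "basis_ell2 []"]]])
      (simp add: \<Phi>_def)
  moreover have "\<Phi> id = mat 1" using id by (simp add: \<Phi>_def vector_eval_basis)
  moreover have "\<Phi> (left_creation i) = A i" for i
    using gen by (simp add: \<Phi>_def vector_eval_left_creation vector_eval_basis)
  moreover have "\<Phi> (op_add X Y) = \<Phi> X + \<Phi> Y \<and> \<Phi> (X \<circ> Y) = \<Phi> X ** \<Phi> Y"
    if "X \<in> free_semigroup_algebra" "Y \<in> free_semigroup_algebra" for X Y
    using free_semigroup_algebra_closed(1,2)[OF that] that
      vector_eval_FSA[OF that(1), of "Y (basis_ell2 [])"]
    unfolding \<Phi>_def restrict_def by (simp only: if_True o_apply simp_thms) (simp add: op_add_def vector_eval_add)
  moreover have "\<Phi> (op_scale c X) = mat_scale c (\<Phi> X)" if "X \<in> free_semigroup_algebra" for X c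
    using free_semigroup_algebra_closed(3)[OF that that] that
    unfolding \<Phi>_def restrict_def by (simp only: if_True) (simp only: op_scale_def vector_eval_scale)
  ultimately have rep: "is_wot_representation A \<Phi>" unfolding is_wot_representation_def by blast
  have "Phi A = \<Phi>" unfolding Phi_def
  proof (rule the_equality)
    show "\<Phi> \<in> extensional free_semigroup_algebra \<and> is_wot_representation A \<Phi>"
      using rep by (simp add: \<Phi>_def)
    fix \<Psi> assume P: "\<Psi> \<in> extensional free_semigroup_algebra \<and> is_wot_representation A \<Psi>"
    show "\<Psi> = \<Phi>"
      by (rule extensionalityI[of _ free_semigroup_algebra])
        (use P wot_representation_eq in \<open>auto simp: \<Phi>_def\<close>)
  qed
  then show ?thesis using X by (simp add: \<Phi>_def)
qed

end

section \<open>Schreier bases and non-commutative polynomials\<close>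

lemma mat_scale_nth [simp]: "mat_scale c M $ k $ l = c * M $ k $ l"
  by (simp add: mat_scale_def map_matrix_def)

lemma matrix_nth_eqI: "(\<And>k l. M $ k $ l = N $ k $ l) \<Longrightarrow> M = N"
  by (simp add: vec_eq_iff)

global_interpretation mats: vector_space "mat_scale :: complex \<Rightarrow> complex ^ 'd ^ 'd \<Rightarrow> complex ^ 'd ^ 'd"
  by unfold_locales (rule matrix_nth_eqI; simp add: algebra_simps)+

lemma mat_mult_bilinear:
  fixes M :: "complex ^ 'd ^ 'd" and N P :: "complex ^ 'd ^ 'd"
  shows "(M + N) ** P = M ** P + N ** P" "P ** (M + N) = P ** M + P ** N"
    "mat_scale c M ** P = mat_scale c (M ** P)" "P ** mat_scale c M = mat_scale c (P ** M)"
    "0 ** P = 0" "P ** 0 = 0"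
  by (rule matrix_nth_eqI;
      simp add: matrix_matrix_mult_def distrib_right distrib_left sum.distrib sum_distrib_left mult_ac)+

lemma mat_mult_sum:
  fixes P :: "complex ^ 'd ^ 'd"
  shows "(\<Sum>i\<in>I. f i) ** P = (\<Sum>i\<in>I. f i ** P)" "P ** (\<Sum>i\<in>I. f i) = (\<Sum>i\<in>I. P ** f i)"
  by (induction I rule: infinite_finite_induct) (simp_all add: mat_mult_bilinear)

lemma mat_scale_vector_mult: "mat_scale c M *v u = c *s (M *v u)"
  by (simp add: vec_eq_iff matrix_vector_mult_def sum_distrib_left mult_ac)

definition matrix_unit :: "'d \<Rightarrow> 'd \<Rightarrow> complex ^ 'd ^ 'd" where
  "matrix_unit k l = (\<chi> i j. if i = k \<and> j = l then 1 else 0)"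

lemma matrix_unit_nth [simp]: "matrix_unit k l $ i $ j = (if i = k \<and> j = l then 1 else 0)"
  by (simp add: matrix_unit_def)

lemma sum_if_pair:
  fixes f :: "'a::finite \<Rightarrow> 'a \<Rightarrow> complex"
  shows "(\<Sum>p\<in>UNIV. if i = fst p \<and> j = snd p then f (fst p) (snd p) else 0) = f i j"
proof -
  have "(\<Sum>p\<in>UNIV. if i = fst p \<and> j = snd p then f (fst p) (snd p) else 0) =
      (\<Sum>p\<in>{(i, j)}. f (fst p) (snd p))"
    by (rule sum.mono_neutral_cong_right) auto
  then show ?thesis by simp
qed

lemma matrix_unit_expansion:
  "M = (\<Sum>p\<in>UNIV. mat_scale (M $ fst p $ snd p) (matrix_unit (fst p) (snd p)))"
  by (rule matrix_nth_eqI)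
    (simp add: if_distrib[of "\<lambda>c. _ * c"] sum_if_pair[of _ _ "\<lambda>k l. M $ k $ l"] cong: if_cong)

lemma matrix_unit_basis:
  defines "E \<equiv> (\<lambda>p :: 'd::finite \<times> 'd. matrix_unit (fst p) (snd p))"
  shows "mats.independent (range E)" "mats.span (range E) = UNIV" "card (range E) = CARD('d)\<^sup>2"
proof -
  have inj: "inj E"
  proof (rule injI)
    fix p q :: "'d \<times> 'd" assume "E p = E q"
    then have "E p $ fst p $ snd p = E q $ fst p $ snd p" by simp
    then show "p = q" by (auto simp: E_def prod_eq_iff split: if_splits)
  qed
  then show "card (range E) = CARD('d)\<^sup>2" by (simp add: card_image power2_eq_square)
  show "mats.span (range E) = UNIV"
  proof -
    have "M \<in> mats.span (range E)" for M
      by (subst matrix_unit_expansion, intro mats.span_sum mats.span_scale mats.span_base) (auto simp: E_def)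
    then show ?thesis by blast
  qed
  show "mats.independent (range E)"
  proof (rule mats.independent_if_scalars_zero)
    fix c x assume s: "(\<Sum>x\<in>range E. mat_scale (c x) x) = 0" and "x \<in> range E"
    then obtain p where p: "x = E p" by auto
    have "0 = (\<Sum>x\<in>range E. mat_scale (c x) x) $ fst p $ snd p" by (simp add: s)
    also have "\<dots> = (\<Sum>q\<in>UNIV. mat_scale (c (E q)) (E q)) $ fst p $ snd p"
      by (simp add: sum.reindex[OF inj])
    also have "\<dots> = (\<Sum>q\<in>UNIV. if fst p = fst q \<and> snd p = snd q then c (E (fst q, snd q)) else 0)"
      by (simp add: E_def if_distrib[of "\<lambda>c. _ * c"] cong: if_cong)
    also have "\<dots> = c x" unfolding p by (simp add: sum_if_pair[of _ _ "\<lambda>k l. c (E (k, l))"])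
    finally show "c x = 0" by simp
  qed simp
qed

lemma mats_dim: "mats.dim (UNIV :: (complex ^ 'd::finite ^ 'd) set) = CARD('d)\<^sup>2"
  by (rule mats.dim_unique[OF _ _ matrix_unit_basis(1)]) (auto simp: matrix_unit_basis)

lemma irreducible_span_words:
  assumes "irreducible_tuple A"
  shows "mats.span (range (eval_word A)) = UNIV"
proof -
  have "M \<in> mats.span (range (eval_word A))" if "M \<in> generated_algebra (mat 1) (+) (**) mat_scale (range A)" for M
    using that
  proof (induction rule: generated_algebra.induct)
    case (generator M)
    then obtain i where "M = A i" by auto
    then have "M = eval_word A [i]" by simp
    then show ?case by (metis mats.span_base rangeI)
  next
    case one
    have "mat 1 = eval_word A []" by simp
    then show ?case by (metis mats.span_base rangeI)
  next
    case (mult M N)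
    have "eval_word A w ** N \<in> mats.span (range (eval_word A))" for w
      using mult.IH(2)
    proof (induction rule: mats.span_induct_alt)
      case (step c P Q)
      then obtain v where "P = eval_word A v" by auto
      then have "eval_word A w ** P = eval_word A (w @ v)" by (simp add: eval_word_append)
      then have "eval_word A w ** P \<in> mats.span (range (eval_word A))" by (auto intro: mats.span_base)
      then show ?case using step by (simp add: mat_mult_bilinear mats.span_add mats.span_scale)
    qed (simp add: mat_mult_bilinear mats.span_zero)
    note * = this
    show ?case using mult.IH(1)
    proof (induction rule: mats.span_induct_alt)
      case (step c P Q)
      then show ?case using * by (auto simp: mat_mult_bilinear mats.span_add mats.span_scale)
    qed (simp add: mat_mult_bilinear mats.span_zero)
  qed (auto intro: mats.span_add mats.span_scale)
  then show ?thesis using assms by (auto simp: irreducible_tuple_def)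
qed

text \<open>A Schreier transversal of the ideal of relations of \<open>A\<close>.\<close>

locale schreier_basis =
  fixes A :: "('n::finite, 'd::finite) tuple" and S :: "'n list set"
  assumes finite_S: "finite S" and inj: "inj_on (eval_word A) S"
    and indep: "mats.independent (eval_word A ` S)" and span: "mats.span (eval_word A ` S) = UNIV"
    and prefix: "w @ [i] \<in> S \<Longrightarrow> w \<in> S" and Nil: "[] \<in> S"

text \<open>Dimension bounds the prefix-closed sets with independent words, so one of maximal size
  exists. By maximality each one-letter extension, and the empty word, evaluates into the span,
  which is therefore closed under right multiplication by the letters and contains the
  identity.\<close>

lemma schreier_basis_exists:
  fixes A :: "('n::finite, 'd::finite) tuple"
  assumes "irreducible_tuple A"
  obtains S where "schreier_basis A S"
proof -
  define P where "P S \<longleftrightarrow> finite S \<and> inj_on (eval_word A) S \<and>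
    mats.independent (eval_word A ` S) \<and> (\<forall>w i. w @ [i] \<in> S \<longrightarrow> w \<in> S)" for S :: "'n list set"
  have bound: "card S < Suc (CARD('d)\<^sup>2)" if "P S" for S
  proof -
    have "card (eval_word A ` S) \<le> CARD('d)\<^sup>2"
      using mats.independent_span_bound[of "range (\<lambda>p. matrix_unit (fst p) (snd p))" "eval_word A ` S"]
        that by (auto simp: P_def matrix_unit_basis)
    then show ?thesis using that by (simp add: P_def card_image)
  qed
  have "P {}" by (simp add: P_def mats.independent_empty)
  then have "\<exists>S. P S \<and> (\<forall>R. P R \<longrightarrow> card R \<le> card S)"
    by (rule ex_has_greatest_nat) (use bound in blast)
  then obtain S where S: "P S" and max: "\<And>R. P R \<Longrightarrow> card R \<le> card S" by blast
  have extend: "eval_word A w \<in> mats.span (eval_word A ` S)"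
    if "w = [] \<or> butlast w \<in> S" for w
  proof (rule ccontr)
    assume n: "eval_word A w \<notin> mats.span (eval_word A ` S)"
    then have "w \<notin> S" "eval_word A w \<notin> eval_word A ` S" by (auto intro: mats.span_base)
    moreover have "P (insert w S)"
      using S n that \<open>eval_word A w \<notin> eval_word A ` S\<close>
      by (auto simp: P_def mats.independent_insertI)
    ultimately show False using max[of "insert w S"] S by (simp add: P_def)
  qed
  have "S \<noteq> {}"
  proof
    assume "S = {}"
    then have "(mat 1 :: complex ^ 'd ^ 'd) = 0" using extend[of "[]"] by simp
    then have "(mat 1 :: complex ^ 'd ^ 'd) $ k $ k = 0" for k by simp
    then show False by (simp add: mat_def)
  qed
  moreover have "w \<in> S \<Longrightarrow> [] \<in> S" for w
    using S by (induction w rule: rev_induct) (auto simp: P_def)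
  ultimately have Nil: "[] \<in> S" by blast
  have right: "M ** A i \<in> mats.span (eval_word A ` S)" if "M \<in> mats.span (eval_word A ` S)" for M i
    using that
  proof (induction rule: mats.span_induct_alt)
    case (step c P Q)
    then obtain w where "w \<in> S" "P = eval_word A w" by auto
    then have "P ** A i \<in> mats.span (eval_word A ` S)"
      using extend[of "w @ [i]"] by (simp add: eval_word_snoc)
    then show ?case using step by (simp add: mat_mult_bilinear mats.span_add mats.span_scale)
  qed (simp add: mat_mult_bilinear mats.span_zero)
  have words: "eval_word A w \<in> mats.span (eval_word A ` S)" for w
  proof (induction w rule: rev_induct)
    case Nil
    then show ?case using extend[of "[]"] by simp
  next
    case (snoc i w)
    then show ?case using right by (simp add: eval_word_snoc)
  qed
  have "mats.span (range (eval_word A)) \<subseteq> mats.span (eval_word A ` S)"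
    using words by (intro mats.span_minimal mats.subspace_span) auto
  then have "mats.span (eval_word A ` S) = UNIV"
    using irreducible_span_words[OF assms] by auto
  then have "schreier_basis A S"
    using S Nil by unfold_locales (auto simp: P_def)
  then show thesis by (rule that)
qed

lemma invertible_matrix_inv:
  fixes T :: "complex ^ 'd ^ 'd"
  assumes "invertible T" shows "T ** matrix_inv T = mat 1" "matrix_inv T ** T = mat 1"
  using someI_ex[OF assms[unfolded invertible_def]] by (auto simp: matrix_inv_def)

text \<open>Skolem-Noether: a unital endomorphism \<open>\<psi>\<close> of the matrix algebra is inner, intertwined by the matrix
  with columns \<open>\<psi>(e\<^sub>j\<^sub>k) u\<close> for a fixed \<open>k\<close> and a nonzero \<open>u\<close> in the range of \<open>\<psi>(e\<^sub>k\<^sub>k)\<close>.\<close>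

lemma matrix_endomorphism_inner:
  fixes \<psi> :: "complex ^ 'd::finite ^ 'd \<Rightarrow> complex ^ 'd ^ 'd"
  assumes add: "\<And>M N. \<psi> (M + N) = \<psi> M + \<psi> N" and scale: "\<And>c M. \<psi> (mat_scale c M) = mat_scale c (\<psi> M)"
    and mult: "\<And>M N. \<psi> (M ** N) = \<psi> M ** \<psi> N" and one: "\<psi> (mat 1) = mat 1"
  obtains T where "invertible T" "\<And>M. \<psi> M = T ** M ** matrix_inv T"
proof -
  have zero: "\<psi> 0 = 0" using add[of 0 0] by simp
  have sum: "\<psi> (\<Sum>i\<in>I. f i) = (\<Sum>i\<in>I. \<psi> (f i))" for f :: "'e \<Rightarrow> complex ^ 'd ^ 'd" and I
    by (induction I rule: infinite_finite_induct) (simp_all add: add zero)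
  obtain k :: 'd where True by blast
  let ?e = "\<lambda>j. matrix_unit j k"
  have unit_mult: "matrix_unit i j ** matrix_unit j l = (matrix_unit i l :: complex ^ 'd ^ 'd)" for i j l
  proof (rule matrix_nth_eqI)
    fix a b
    have "(matrix_unit i j ** matrix_unit j l) $ a $ b =
        (\<Sum>c\<in>UNIV. if c = j then (if a = i \<and> b = l then 1 else 0) else (0 :: complex))"
      unfolding matrix_matrix_mult_def vec_lambda_beta by (rule sum.cong) auto
    then show "(matrix_unit i j ** matrix_unit j l) $ a $ b = (matrix_unit i l :: complex ^ 'd ^ 'd) $ a $ b"
      by simp
  qed
  have "\<psi> (?e k) \<noteq> 0"
  proof
    assume z: "\<psi> (?e k) = 0"
    \<comment> \<open>Every diagonal unit factors through \<open>?e k\<close>, so its vanishing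
      under \<psi> would make the image of the identity 0.\<close>
    have "\<psi> (matrix_unit j j) = \<psi> (matrix_unit j k) ** \<psi> (?e k) ** \<psi> (matrix_unit k j)" for j
      unfolding mult[symmetric] unit_mult ..
    then have "\<psi> (matrix_unit j j) = 0" for j by (simp add: z mat_mult_bilinear)
    moreover have "mat 1 = (\<Sum>j\<in>UNIV. matrix_unit j j :: complex ^ 'd ^ 'd)"
      by (rule matrix_nth_eqI) (auto simp: mat_def intro!: sum.neutral)
    ultimately have "(mat 1 :: complex ^ 'd ^ 'd) = 0" using one sum[of "\<lambda>j. matrix_unit j j" UNIV] by simp
    then have "(mat 1 :: complex ^ 'd ^ 'd) $ k $ k = 0" by simp
    then show False by (simp add: mat_def)
  qed
  then obtain v where v: "\<psi> (?e k) *v v \<noteq> 0" by (metis matrix_eq matrix_vector_mult_0)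
  define u where "u = \<psi> (?e k) *v v"
  define T :: "complex ^ 'd ^ 'd" where "T = (\<chi> i j. (\<psi> (?e j) *v u) $ i)"
  \<comment> \<open>Placing \<open>x\<close> in column \<open>k\<close> turns the action on vectors
    into matrix multiplication, so intertwining becomes multiplicativity of \<psi>.\<close>
  define col :: "complex ^ 'd \<Rightarrow> complex ^ 'd ^ 'd" where "col x = (\<chi> i j. if j = k then x $ i else 0)" for x
  have col_sum: "col x = (\<Sum>j\<in>UNIV. mat_scale (x $ j) (?e j))" for x
    by (rule matrix_nth_eqI) (auto simp: col_def if_distrib[of "\<lambda>c. _ * c"] cong: if_cong)
  have col_mult: "M ** col x = col (M *v x)" for M x
    by (rule matrix_nth_eqI) (auto simp: col_def matrix_matrix_mult_def matrix_vector_mult_def)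
  have T: "T *v x = \<psi> (col x) *v u" for x
  proof -
    have "(\<Sum>j\<in>J. mat_scale (x $ j) (\<psi> (?e j))) *v u = (\<Sum>j\<in>J. x $ j *s (\<psi> (?e j) *v u))" for J
      by (induction J rule: infinite_finite_induct)
        (simp_all add: matrix_vector_mult_add_rdistrib mat_scale_vector_mult)
    then show ?thesis
      by (simp add: col_sum sum scale vec_eq_iff) (simp add: T_def matrix_vector_mult_def mult.commute)
  qed
  have intertwine: "\<psi> M ** T = T ** M" for M
    unfolding matrix_eq by (simp add: matrix_vector_mul_assoc[symmetric] T) (simp add: matrix_vector_mul_assoc mult[symmetric] col_mult)
  have "x = 0" if x: "T *v x = 0" for x
  proof (rule ccontr)
    assume "x \<noteq> 0"
    then obtain j where j: "x $ j \<noteq> 0" by (auto simp: vec_eq_iff)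
    \<comment> \<open>Chosen to send \<open>x\<close> to the unit vector at \<open>k\<close>; then
      \<open>T *v x = 0\<close> would annihilate \<psi>\<open>(?e k) *v u\<close>, which equals the
      nonzero \<open>u\<close>.\<close>
    define M where "M = mat_scale (inverse (x $ j)) (matrix_unit k j)"
    have "M *v x = axis k 1"
      using j by (auto simp: vec_eq_iff M_def matrix_vector_mult_def axis_def if_distrib[of "\<lambda>c. _ * c"]
          if_distrib[of "\<lambda>c. c * _"] cong: if_cong)
    moreover have "col (axis k 1) = ?e k"
      by (rule matrix_nth_eqI) (auto simp: col_def axis_def)
    ultimately have "\<psi> (?e k) *v u = (T ** M) *v x"
      by (simp add: T matrix_vector_mul_assoc[symmetric])
    also have "\<dots> = 0" by (simp add: intertwine[symmetric] matrix_vector_mul_assoc[symmetric] x)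
    finally have "\<psi> (?e k ** ?e k) *v v = 0" by (simp add: mult u_def matrix_vector_mul_assoc)
    then show False using v by (simp add: unit_mult)
  qed
  then have "inj ((*v) T)"
    by (intro injI) (metis eq_iff_diff_eq_0 matrix_vector_mult_diff_distrib)
  then have inv: "invertible T"
    by (simp add: invertible_left_inverse matrix_left_invertible_injective)
  have "\<psi> M = T ** M ** matrix_inv T" for M
    using invertible_matrix_inv(1)[OF inv] by (simp add: intertwine[symmetric] matrix_mul_assoc[symmetric])
  with inv show thesis by (rule that)
qed

lemma similar_tuples_eval_word:
  fixes A B :: "('n::finite, 'd::finite) tuple" and T :: "complex ^ 'd ^ 'd"
  assumes "invertible T" "\<And>i. B i = T ** A i ** matrix_inv T"
  shows "eval_word B w = T ** eval_word A w ** matrix_inv T"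
proof (induction w)
  case Nil
  then show ?case using invertible_matrix_inv[OF assms(1)] by simp
next
  case (Cons i w)
  have "eval_word B (i # w) = T ** A i ** (matrix_inv T ** T) ** (eval_word A w ** matrix_inv T)"
    by (simp only: eval_word_simps Cons.IH assms(2) matrix_mul_assoc)
  then show ?case using invertible_matrix_inv[OF assms(1)] by (simp add: matrix_mul_assoc)
qed

lemma mats_representation_expansion:
  "finite S \<Longrightarrow> inj_on f S \<Longrightarrow> mats.independent (f ` S) \<Longrightarrow> mats.span (f ` S) = UNIV \<Longrightarrow>
    (\<Sum>v\<in>S. mat_scale (mats.representation (f ` S) M (f v)) (f v)) = M"
  using mats.sum_representation_eq[of "f ` S" M "f ` S"] by (simp add: sum.reindex)

section \<open>Relations leaving a Schreier basis\<close>

context schreier_basis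
begin

definition coord :: "complex ^ 'd ^ 'd \<Rightarrow> 'n list \<Rightarrow> complex" where
  "coord M v = mats.representation (eval_word A ` S) M (eval_word A v)"

lemma coord_expansion: "(\<Sum>v\<in>S. mat_scale (coord M v) (eval_word A v)) = M"
  unfolding coord_def by (rule mats_representation_expansion[OF finite_S inj indep span])

lemma coord_linear: "coord (M + N) v = coord M v + coord N v" "coord (mat_scale c M) v = c * coord M v"
  using span by (simp_all add: coord_def mats.representation_add[OF indep] mats.representation_scale[OF indep])

lemma coord_word: "v \<in> S \<Longrightarrow> w \<in> S \<Longrightarrow> coord (eval_word A w) v = (if v = w then 1 else 0)"
  using inj by (auto simp: coord_def mats.representation_basis[OF indep] inj_on_def)

lemma card_S: "card S = CARD('d)\<^sup>2"
proof -
  have "card (eval_word A ` S) = mats.dim (UNIV :: (complex ^ 'd ^ 'd) set)"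
    using mats.dim_unique[OF _ _ indep refl, of UNIV] span by simp
  then show ?thesis by (simp add: card_image[OF inj] mats_dim)
qed

definition boundary :: "('n list \<times> 'n) set" where
  "boundary = {(w, i). w \<in> S \<and> w @ [i] \<notin> S}"

lemma finite_boundary: "finite boundary"
  by (rule finite_subset[of _ "S \<times> UNIV"]) (auto simp: boundary_def finite_S)

text \<open>Pairs that stay inside \<open>S\<close> correspond to its nonempty words, by splitting
  off the last letter; prefix closure puts the remaining prefix in \<open>S\<close>.\<close>

lemma card_boundary: "card boundary = 1 + (CARD('n) - 1) * CARD('d)\<^sup>2"
proof -
  define R where "R = {(w, i). w @ [i] \<in> S}"
  have R: "bij_betw (\<lambda>(w, i). w @ [i]) R (S - {[]})"
    unfolding bij_betw_def
  proof
    show "(\<lambda>(w, i). w @ [i]) ` R = S - {[]}"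
    proof
      show "S - {[]} \<subseteq> (\<lambda>(w, i). w @ [i]) ` R"
      proof
        fix v assume v: "v \<in> S - {[]}"
        then have "v = (\<lambda>(w, i). w @ [i]) (butlast v, last v)" by simp
        moreover have "(butlast v, last v) \<in> R" using v by (simp add: R_def)
        ultimately show "v \<in> (\<lambda>(w, i). w @ [i]) ` R" by (rule image_eqI)
      qed
    qed (auto simp: R_def)
  qed (auto simp: inj_on_def)
  have fin: "finite R" using R finite_S by (simp add: bij_betw_finite)
  have "S \<times> UNIV = boundary \<union> R" "boundary \<inter> R = {}"
    by (auto simp: boundary_def R_def intro: prefix)
  then have "card (S \<times> (UNIV :: 'n set)) = card boundary + card R"
    using fin finite_boundary by (simp add: card_Un_disjoint)
  moreover have "card R = CARD('d)\<^sup>2 - 1"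
    using bij_betw_same_card[OF R] Nil by (simp add: card_S)
  ultimately have "CARD('d)\<^sup>2 * CARD('n) = card boundary + (CARD('d)\<^sup>2 - 1)"
    by (simp add: card_cartesian_product card_S)
  moreover obtain m where "CARD('n) = Suc m" using not0_implies_Suc[of "CARD('n)"] by auto
  moreover obtain e where "CARD('d)\<^sup>2 = Suc e" using not0_implies_Suc[of "CARD('d)\<^sup>2"] by auto
  ultimately show ?thesis by (simp add: algebra_simps)
qed

text \<open>For the linear map sending \<open>A_v\<close> to \<open>B_v\<close> on \<open>S\<close>,
  compatibility with a letter is automatic along pairs inside \<open>S\<close> and is the hypothesis
  along the boundary. Iteration gives compatibility with words, which span, so the map is a unital
  endomorphism.\<close>

lemma similar_if_boundary_relations:
  assumes rel: "\<And>w i. (w, i) \<in> boundary \<Longrightarrow>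
    eval_word B (w @ [i]) = (\<Sum>v\<in>S. mat_scale (coord (eval_word A (w @ [i])) v) (eval_word B v))"
  shows "similar_tuples A B"
proof -
  define \<psi> where "\<psi> M = (\<Sum>v\<in>S. mat_scale (coord M v) (eval_word B v))" for M
  have lin: "\<psi> (M + N) = \<psi> M + \<psi> N" "\<psi> (mat_scale c M) = mat_scale c (\<psi> M)" for M N c
    by (simp_all add: \<psi>_def coord_linear mats.scale_left_distrib sum.distrib mats.scale_sum_right)
  have \<psi>_S: "\<psi> (eval_word A w) = eval_word B w" if "w \<in> S" for w
  proof -
    have "\<psi> (eval_word A w) = (\<Sum>v\<in>S. if v = w then eval_word B v else 0)"
      unfolding \<psi>_def using that by (intro sum.cong refl) (simp add: coord_word)
    then show ?thesis using finite_S that by simp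
  qed
  have zero: "\<psi> 0 = 0" using lin(2)[of 0 0] by simp
  have lin_sum: "\<psi> (\<Sum>i\<in>I. f i) = (\<Sum>i\<in>I. \<psi> (f i))" for f :: "'n list \<Rightarrow> complex ^ 'd ^ 'd" and I
    by (induction I rule: infinite_finite_induct) (simp_all add: lin zero)
  have step: "\<psi> (M ** A i) = \<psi> M ** B i" for M i
  proof -
    have "\<psi> (eval_word A v ** A i) = eval_word B v ** B i" if "v \<in> S" for v
    proof (cases "v @ [i] \<in> S")
      case True
      then show ?thesis using \<psi>_S[OF True] by (simp add: eval_word_snoc)
    next
      case False
      then have "(v, i) \<in> boundary" using that by (simp add: boundary_def)
      then have "\<psi> (eval_word A (v @ [i])) = eval_word B (v @ [i])"
        using rel by (simp add: \<psi>_def)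
      then show ?thesis by (simp add: eval_word_snoc)
    qed
    then have "\<psi> ((\<Sum>v\<in>S. mat_scale (coord M v) (eval_word A v)) ** A i) =
        (\<Sum>v\<in>S. mat_scale (coord M v) (eval_word B v)) ** B i"
      by (simp add: mat_mult_sum mat_mult_bilinear lin_sum lin)
    then show ?thesis by (simp add: coord_expansion \<psi>_def)
  qed
  have word: "\<psi> (M ** eval_word A w) = \<psi> M ** eval_word B w" for M w
  proof (induction w rule: rev_induct)
    case (snoc i w)
    then show ?case by (simp add: eval_word_snoc matrix_mul_assoc step)
  qed simp
  have one: "\<psi> (mat 1) = mat 1" using \<psi>_S[OF Nil] by simp
  have "\<psi> (M ** N) = \<psi> M ** \<psi> N" for M N
  proof -
    have "\<psi> (M ** (\<Sum>v\<in>S. mat_scale (coord N v) (eval_word A v))) =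
        \<psi> M ** (\<Sum>v\<in>S. mat_scale (coord N v) (eval_word B v))"
      by (simp add: mat_mult_sum mat_mult_bilinear lin_sum lin word)
    then show ?thesis by (simp add: coord_expansion \<psi>_def)
  qed
  then obtain T where "invertible T" "\<And>M. \<psi> M = T ** M ** matrix_inv T"
    using matrix_endomorphism_inner[of \<psi>] lin one by blast
  moreover have "\<psi> (A i) = B i" for i
    using step[of "mat 1" i] by (simp add: one)
  ultimately show ?thesis unfolding similar_tuples_def by metis
qed

text \<open>The monomial \<open>wi\<close> minus its normal form, the combination of words in
  \<open>S\<close> with the same value at \<open>A\<close>.\<close>

definition relator :: "'n list \<times> 'n \<Rightarrow> 'n nc_poly" where
  "relator = (\<lambda>(w, i). Poly_Mapping.single (w @ [i]) 1 -
     (\<Sum>v\<in>S. Poly_Mapping.single v (coord (eval_word A (w @ [i])) v)))"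

end

lemma eval_nc_poly_superset:
  assumes "finite F" "Poly_Mapping.keys p \<subseteq> F"
  shows "eval_nc_poly p B = (\<Sum>w\<in>F. mat_scale (Poly_Mapping.lookup p w) (eval_word B w))"
  unfolding eval_nc_poly_def
  by (rule sum.mono_neutral_left[OF assms]) (auto simp: in_keys_iff)

lemma eval_nc_poly_diff: "eval_nc_poly (p - q) B = eval_nc_poly p B - eval_nc_poly q B"
proof -
  let ?F = "Poly_Mapping.keys p \<union> Poly_Mapping.keys q"
  have "Poly_Mapping.keys (p - q) \<subseteq> ?F" by (auto simp: in_keys_iff lookup_minus)
  then show ?thesis
    by (simp add: eval_nc_poly_superset[of ?F] lookup_minus mats.scale_left_diff_distrib sum_subtractf)
qed

lemma eval_nc_poly_single: "eval_nc_poly (Poly_Mapping.single w c) B = mat_scale c (eval_word B w)"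
  by (simp add: eval_nc_poly_def)

lemma eval_nc_poly_sum: "eval_nc_poly (\<Sum>i\<in>I. f i) B = (\<Sum>i\<in>I. eval_nc_poly (f i) B)"
proof (induction I rule: infinite_finite_induct)
  case (insert i I)
  have "eval_nc_poly (f i + sum f I) B = eval_nc_poly (f i) B + eval_nc_poly (sum f I) B"
    using eval_nc_poly_diff[of "f i + sum f I" "sum f I" B] by (simp add: algebra_simps)
  then show ?case using insert by simp
qed (simp_all add: eval_nc_poly_def)

lemma similar_tuples_eval_nc_poly:
  fixes A B :: "('n::finite, 'd::finite) tuple" and T :: "complex ^ 'd ^ 'd"
  assumes "invertible T" "\<And>i. B i = T ** A i ** matrix_inv T"
  shows "eval_nc_poly p B = T ** eval_nc_poly p A ** matrix_inv T"
  by (simp add: eval_nc_poly_def similar_tuples_eval_word[OF assms] mat_mult_sum mat_mult_bilinear)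

lemma (in schreier_basis) eval_relator:
  "eval_nc_poly (relator (w, i)) B = eval_word B (w @ [i]) -
    (\<Sum>v\<in>S. mat_scale (coord (eval_word A (w @ [i])) v) (eval_word B v))"
  by (simp add: relator_def eval_nc_poly_diff eval_nc_poly_sum eval_nc_poly_single)

lemma (in schreier_basis) similar_iff_relators:
  "similar_tuples A B \<longleftrightarrow> (\<forall>x\<in>boundary. eval_nc_poly (relator x) B = 0)"
proof
  assume "similar_tuples A B"
  then obtain T where "invertible T" "\<And>i. B i = T ** A i ** matrix_inv T"
    unfolding similar_tuples_def by blast
  then have "eval_nc_poly (relator x) B = T ** eval_nc_poly (relator x) A ** matrix_inv T" for x
    by (rule similar_tuples_eval_nc_poly)
  moreover have "eval_nc_poly (relator x) A = 0" for x
    by (cases x) (simp add: eval_relator coord_expansion)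
  ultimately show "\<forall>x\<in>boundary. eval_nc_poly (relator x) B = 0"
    by (simp add: mat_mult_bilinear)
next
  assume "\<forall>x\<in>boundary. eval_nc_poly (relator x) B = 0"
  then show "similar_tuples A B"
    by (intro similar_if_boundary_relations) (auto simp: eval_relator)
qed

text \<open>The monomial \<open>wi\<close> lies outside \<open>S\<close>, so among the relators it
  occurs only in its own.\<close>

lemma (in schreier_basis) inj_on_relator: "inj_on relator boundary"
proof (rule inj_onI)
  fix x y assume xy: "x \<in> boundary" "y \<in> boundary" "relator x = relator y"
  obtain w i v j where eq: "x = (w, i)" "y = (v, j)" by (cases x, cases y)
  have lookup: "Poly_Mapping.lookup (relator (v, j)) (w @ [i]) = (if v @ [j] = w @ [i] then 1 else 0)" for v j
  proof -
    have "w @ [i] \<notin> S" using xy(1) by (simp add: eq boundary_def)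
    then have "(\<Sum>u\<in>S. Poly_Mapping.lookup (Poly_Mapping.single u (coord (eval_word A (v @ [j])) u)) (w @ [i])) = 0"
      by (intro sum.neutral) (auto simp: lookup_single when_def)
    then show ?thesis
      by (simp add: relator_def lookup_minus lookup_sum) (simp add: lookup_single when_def)
  qed
  have "Poly_Mapping.lookup (relator x) (w @ [i]) = Poly_Mapping.lookup (relator y) (w @ [i])"
    using xy(3) by simp
  then show "x = y" using lookup[of w i] lookup[of v j] by (auto simp: eq split: if_splits)
qed

section \<open>The kernel and its wandering spaces\<close>

lemma vector_eval_eq_0_iff: "vector_eval A x = 0 \<longleftrightarrow> (\<forall>p. cinner_ell2 x (word_vector A (fst p) (snd p)) = 0)"
  by (auto simp: vector_eval_def vec_eq_iff)

text \<open>Conjugation by \<open>T\<close> makes the word vectors of \<open>B\<close> finite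
  combinations of those of \<open>A\<close>.\<close>

lemma similar_tuples_vector_eval_eq_0:
  assumes "square_summable_tuple A" "square_summable_tuple B" "similar_tuples A B" "vector_eval A x = 0"
  shows "vector_eval B x = 0"
proof -
  interpret A: square_summable_tuple A by fact
  interpret B: square_summable_tuple B by fact
  obtain T where "invertible T" "\<And>i. B i = T ** A i ** matrix_inv T"
    using assms(3) unfolding similar_tuples_def by blast
  note word = similar_tuples_eval_word[OF this]
  have "word_vector B k l = (\<Sum>m\<in>UNIV. \<Sum>p\<in>UNIV.
      scale_ell2 (cnj (T $ k $ p) * cnj (matrix_inv T $ m $ l)) (word_vector A p m))" for k l
    by (rule ell2_eqI)
      (simp add: A.Rep_word_vector B.Rep_word_vector word matrix_matrix_mult_def sum_distrib_right
        mult.assoc mult.commute[of "cnj (matrix_inv T $ _ $ _)"])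
  moreover have "cinner_ell2 x (word_vector A k l) = 0" for k l
    using assms(4) by (simp add: vector_eval_def vec_eq_iff)
  ultimately show ?thesis
    by (simp add: vector_eval_def vec_eq_iff cinner_ell2_sum_right cinner_ell2_scale_right)
qed

locale square_summable_schreier = square_summable_tuple A + schreier_basis A S
  for A :: "('n::finite, 'd::finite) tuple" and S
begin

text \<open>A linear right inverse of \<open>vector_eval A\<close> whose values are supported on
  \<open>S\<close>. Applied to matrix units it is dual to the word vectors.\<close>

definition polynomial_vector :: "complex ^ 'd ^ 'd \<Rightarrow> 'n list ell2" where
  "polynomial_vector M = (\<Sum>v\<in>S. scale_ell2 (coord M v) (basis_ell2 v))"

lemma vector_eval_polynomial_vector: "vector_eval A (polynomial_vector M) = M"
  by (simp add: polynomial_vector_def vector_eval_sum vector_eval_scale vector_eval_basis coord_expansion)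

abbreviation annihilator_vector :: "'d \<times> 'd \<Rightarrow> 'n list ell2" where
  "annihilator_vector p \<equiv> word_vector A (fst p) (snd p)"

abbreviation dual_vector :: "'d \<times> 'd \<Rightarrow> 'n list ell2" where
  "dual_vector p \<equiv> polynomial_vector (matrix_unit (fst p) (snd p))"

lemma cinner_dual_vector: "cinner_ell2 (dual_vector p) (annihilator_vector r) = (if p = r then 1 else 0)"
proof -
  have "cinner_ell2 (dual_vector p) (annihilator_vector r) = vector_eval A (dual_vector p) $ fst r $ snd r"
    by (simp add: vector_eval_def)
  then show ?thesis by (auto simp: vector_eval_polynomial_vector prod_eq_iff)
qed

text \<open>The wandering space of the statement is taken with respect to the left creation operators, while
  isometries of the algebra come from vectors that wander for the right creation operators. Reversal
  of words exchanges both, so the same result is used for the kernel and for its reversal.\<close>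

sublocale left: biorthogonal_family annihilator_vector dual_vector
proof
  fix x i s assume "\<And>t. cinner_ell2 x (annihilator_vector t) = 0"
  then have "vector_eval A (left_creation i x) = 0"
    by (simp add: vector_eval_left_creation vector_eval_eq_0_iff[THEN iffD2] mat_mult_bilinear)
  then show "cinner_ell2 (left_creation i x) (annihilator_vector s) = 0"
    by (simp only: vector_eval_eq_0_iff)
qed (rule cinner_dual_vector)

sublocale right: biorthogonal_family "\<lambda>p. flip_ell2 (annihilator_vector p)" "\<lambda>p. flip_ell2 (dual_vector p)"
proof
  fix x i s assume "\<And>t. cinner_ell2 x (flip_ell2 (annihilator_vector t)) = 0"
  then have "vector_eval A (flip_ell2 x) = 0"
    by (simp add: cinner_flip_left vector_eval_eq_0_iff)
  then have "vector_eval A (flip_ell2 (left_creation i x)) = 0"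
    by (simp add: vector_eval_flip_left_creation mat_mult_bilinear)
  then have "cinner_ell2 (flip_ell2 (left_creation i x)) (annihilator_vector s) = 0"
    by (simp only: vector_eval_eq_0_iff)
  then show "cinner_ell2 (left_creation i x) (flip_ell2 (annihilator_vector s)) = 0"
    by (simp only: cinner_flip_left)
qed (simp only: cinner_flip_flip cinner_dual_vector)

lemma left_M: "left.M = {x. vector_eval A x = 0}"
  by (simp add: left.M_def vector_eval_eq_0_iff)

lemma right_M: "right.M = {x. vector_eval A (flip_ell2 x) = 0}"
  by (simp add: right.M_def vector_eval_eq_0_iff cinner_flip_left)

text \<open>The issue is that polynomials in the kernel already give a dense subset of
  \<open>left.M\<close>. A continuous projection onto \<open>left.M\<close> that preserves finite
  support carries the dense finitely supported vectors to vectors \<open>X \<xi>\<close> with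
  \<open>X\<close> a polynomial in the kernel.\<close>

lemma range_space_ker_Phi: "range_space (ker_Phi A) = left.M"
proof
  have "{X x | X x. X \<in> ker_Phi A} \<subseteq> left.M"
  proof safe
    fix X x assume "X \<in> ker_Phi A"
    then have X: "X \<in> free_semigroup_algebra" "vector_eval A (X (basis_ell2 [])) = 0"
      using Phi_eq by (auto simp: ker_Phi_def)
    then show "X x \<in> left.M" using vector_eval_FSA[OF X(1), of x] by (simp add: left_M mat_mult_bilinear)
  qed
  then have "ell2.span {X x | X x. X \<in> ker_Phi A} \<subseteq> left.M"
    by (intro ell2.span_minimal left.subspace_M)
  moreover have "closed left.M"
  proof -
    have "left.M = (\<Inter>p. {x. cinner_ell2 x (annihilator_vector p) = 0})"
      by (auto simp: left.M_def)
    also have "closed \<dots>"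
      by (intro closed_INT ballI closed_Collect_eq continuous_on_const
          linear_continuous_on bounded_linear_cinner_ell2)
    finally show ?thesis .
  qed
  ultimately show "range_space (ker_Phi A) \<subseteq> left.M"
    unfolding range_space_def by (rule closure_minimal)
next
  define \<pi> where "\<pi> x = x - (\<Sum>p\<in>UNIV. scale_ell2 (cinner_ell2 x (annihilator_vector p)) (dual_vector p))" for x
  have cont: "continuous_on UNIV \<pi>"
  proof -
    have lin: "bounded_linear (\<lambda>x. scale_ell2 (cinner_ell2 x y) z)" for y z :: "'n list ell2"
    proof (rule bounded_linear_intro[where K = "norm y * norm z"])
      show "norm (scale_ell2 (cinner_ell2 x y) z) \<le> norm x * (norm y * norm z)" for x
        using mult_right_mono[OF cmod_cinner_ell2_le[of x y] norm_ge_zero[of z]]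
        by (simp add: mult.assoc)
    qed (simp_all add: cinner_ell2_add_left ell2.scale_left_distrib scaleR_ell2_def cinner_ell2_scale_left)
    show ?thesis unfolding \<pi>_def
      by (intro continuous_intros linear_continuous_on lin)
  qed
  have "\<pi> x \<in> {X x | X x. X \<in> ker_Phi A}" if x: "x \<in> ell2.span (range basis_ell2)" for x
  proof -
    have poly: "\<exists>X\<in>creation_algebra. X (basis_ell2 []) = y" if y: "y \<in> ell2.span (range basis_ell2)" for y :: "'n list ell2"
    proof -
      obtain F where F: "finite F" "truncate_ell2 F y = y" using span_basis_finite_support[OF y] .
      have "left_word v (basis_ell2 []) = basis_ell2 v" for v :: "'n list"
        by (induction v) (simp_all add: left_creation_basis)
      then have "(\<Sum>v\<in>F. scale_ell2 (Rep_ell2 y v) (left_word v (basis_ell2 []))) = y"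
        using F(2) by (simp add: truncate_ell2_finite[OF F(1)])
      then show ?thesis
        using creation_algebra_sum[OF F(1), of "Rep_ell2 y"] by (rule bexI)
    qed
    \<comment> \<open>Finite support survives because the dual vectors are themselves finitely
      supported.\<close>
    have "\<pi> x \<in> ell2.span (range basis_ell2)"
      unfolding \<pi>_def polynomial_vector_def
      by (intro ell2.span_diff x ell2.span_sum ell2.span_scale ell2.span_base rangeI)
    then obtain X where X: "X \<in> creation_algebra" "X (basis_ell2 []) = \<pi> x" using poly by blast
    then have "X \<in> free_semigroup_algebra" using subsetD[OF creation_algebra_subset] by blast
    moreover have "vector_eval A (\<pi> x) = 0"
      using left.M_projection[of x] by (simp add: left_M \<pi>_def)
    ultimately have "X \<in> ker_Phi A" using X(2) by (simp add: ker_Phi_def Phi_eq)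
    then show ?thesis
      unfolding mem_Collect_eq using X(2)[symmetric] by (intro exI[of _ X] exI[of _ "basis_ell2 []"] conjI)
  qed
  then have "\<pi> ` ell2.span (range basis_ell2) \<subseteq> range_space (ker_Phi A)"
    unfolding range_space_def
    by (intro image_subsetI subsetD[OF closure_subset] ell2.span_base) auto
  then have "\<pi> ` closure (ell2.span (range basis_ell2)) \<subseteq> range_space (ker_Phi A)"
    by (intro image_closure_subset continuous_on_subset[OF cont]) (auto simp: range_space_def)
  then have \<pi>_range: "\<pi> x \<in> range_space (ker_Phi A)" for x by (auto simp: closure_span_basis_ell2)
  show "left.M \<subseteq> range_space (ker_Phi A)"
  proof
    fix x assume "x \<in> left.M"
    then have "\<pi> x = x" by (simp add: \<pi>_def left.M_def)
    then show "x \<in> range_space (ker_Phi A)" using \<pi>_range[of x] by simp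
  qed
qed

section \<open>Comparison of kernels and the resulting isometries\<close>

text \<open>Wold decomposition: up to vectors killed by \<open>B\<close>, an element of the kernel can be pushed into words
  of length at least \<open>k\<close> without increasing its norm, and there \<open>vector_eval B\<close> is small.\<close>

lemma kernel_push:
  assumes B: "square_summable_tuple B"
    and dec: "\<And>x. x \<in> right.M \<Longrightarrow> \<exists>y. (\<forall>i. y i \<in> right.M) \<and> (\<Sum>i\<in>UNIV. (norm (y i))\<^sup>2) \<le> (norm x)\<^sup>2 \<and>
       x = (\<Sum>e\<in>E. scale_ell2 (cinner_ell2 x e) e) + (\<Sum>i\<in>UNIV. left_creation i (y i))"
    and E: "\<And>e. e \<in> E \<Longrightarrow> vector_eval B (flip_ell2 e) = 0"
    and x: "x \<in> right.M"
  shows "\<exists>z\<in>right.M. (\<forall>w. length w < k \<longrightarrow> Rep_ell2 z w = 0) \<and> norm z \<le> norm x \<and>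
    vector_eval B (flip_ell2 z) = vector_eval B (flip_ell2 x)"
  using x
proof (induction k arbitrary: x)
  case 0
  then show ?case by auto
next
  case (Suc k)
  interpret B: square_summable_tuple B by fact
  obtain y where y: "\<And>i. y i \<in> right.M" "(\<Sum>i\<in>UNIV. (norm (y i))\<^sup>2) \<le> (norm x)\<^sup>2"
    "x = (\<Sum>e\<in>E. scale_ell2 (cinner_ell2 x e) e) + (\<Sum>i\<in>UNIV. left_creation i (y i))"
    using dec[OF Suc.prems] by blast
  have "\<forall>i. \<exists>z. z \<in> right.M \<and> (\<forall>w. length w < k \<longrightarrow> Rep_ell2 z w = 0) \<and> norm z \<le> norm (y i) \<and>
    vector_eval B (flip_ell2 z) = vector_eval B (flip_ell2 (y i))"
    using Suc.IH[OF y(1)] by blast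
  then obtain z where "\<forall>i. z i \<in> right.M \<and> (\<forall>w. length w < k \<longrightarrow> Rep_ell2 (z i) w = 0) \<and>
      norm (z i) \<le> norm (y i) \<and> vector_eval B (flip_ell2 (z i)) = vector_eval B (flip_ell2 (y i))"
    by (rule choice[THEN exE])
  then have z: "\<And>i. z i \<in> right.M" "\<And>i w. length w < k \<Longrightarrow> Rep_ell2 (z i) w = 0"
    "\<And>i. norm (z i) \<le> norm (y i)" "\<And>i. vector_eval B (flip_ell2 (z i)) = vector_eval B (flip_ell2 (y i))"
    by blast+
  define u where "u = (\<Sum>i\<in>UNIV. left_creation i (z i))"
  have "u \<in> right.M" unfolding u_def
    by (intro ell2.subspace_sum[OF right.subspace_M] right.M_left_creation z)
  moreover have "Rep_ell2 u w = 0" if "length w < Suc k" for w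
    using that z(2) by (cases w) (auto simp: u_def)
  moreover have "norm u \<le> norm x"
  proof -
    have "(norm u)\<^sup>2 \<le> (\<Sum>i\<in>UNIV. (norm (y i))\<^sup>2)"
      unfolding u_def norm_sum_left_creation by (intro sum_mono power_mono z) auto
    also note y(2)
    finally have "(norm u)\<^sup>2 \<le> (norm x)\<^sup>2" .
    then show ?thesis by (rule power2_le_imp_le) simp
  qed
  moreover have "vector_eval B (flip_ell2 u) = vector_eval B (flip_ell2 x)"
  proof -
    have "vector_eval B (flip_ell2 x) = (\<Sum>i\<in>UNIV. vector_eval B (flip_ell2 (y i)) ** B i)"
      by (subst y(3)) (simp add: flip_ell2_add flip_ell2_sum flip_ell2_scale vector_eval_add
          vector_eval_sum vector_eval_scale E B.vector_eval_flip_left_creation)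
    then show ?thesis
      by (simp add: u_def flip_ell2_sum vector_eval_sum B.vector_eval_flip_left_creation z(4))
  qed
  ultimately show ?case by blast
qed

text \<open>After the push, the vector sees only the tail of the word vector of \<open>B\<close>,
  whose norm is as small as desired, while its own norm stays below that of
  \<open>x\<close>.\<close>

lemma kernel_subset:
  assumes B: "square_summable_tuple B"
    and dec: "\<And>x. x \<in> right.M \<Longrightarrow> \<exists>y. (\<forall>i. y i \<in> right.M) \<and> (\<Sum>i\<in>UNIV. (norm (y i))\<^sup>2) \<le> (norm x)\<^sup>2 \<and>
       x = (\<Sum>e\<in>E. scale_ell2 (cinner_ell2 x e) e) + (\<Sum>i\<in>UNIV. left_creation i (y i))"
    and E: "\<And>e. e \<in> E \<Longrightarrow> vector_eval B (flip_ell2 e) = 0"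
    and x: "x \<in> right.M"
  shows "vector_eval B (flip_ell2 x) = 0"
proof (rule matrix_nth_eqI)
  fix k l
  define g where "g = flip_ell2 (word_vector B k l)"
  have small: "cmod (vector_eval B (flip_ell2 x) $ k $ l) \<le> norm x * \<epsilon>" if "\<epsilon> > 0" for \<epsilon>
  proof -
    obtain F where F: "finite F" "\<And>G. F \<subseteq> G \<Longrightarrow> norm (g - truncate_ell2 G g) < \<epsilon>"
      using truncate_ell2_approx[OF \<open>\<epsilon> > 0\<close>, of g] by blast
    define N where "N = Suc (\<Sum>u\<in>F. length u)"
    have N: "length u < N" if "u \<in> F" for u
      unfolding N_def less_Suc_eq_le using that F(1) by (intro member_le_sum[of u F length]) auto
    obtain z where z: "\<And>w. length w < N \<Longrightarrow> Rep_ell2 z w = 0" "norm z \<le> norm x"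
      "vector_eval B (flip_ell2 z) = vector_eval B (flip_ell2 x)"
      using kernel_push[OF B dec E x, of N] by blast
    define t where "t = truncate_ell2 {w. length w < N} g"
    have "cinner_ell2 z t = 0"
      unfolding cinner_ell2.rep_eq by (rule infsum_0) (auto simp: t_def z(1))
    then have "cinner_ell2 z g = cinner_ell2 z (g - t)"
      using cinner_ell2_add_right[of z "g - t" t] by simp
    then have "cmod (cinner_ell2 z g) \<le> norm z * norm (g - t)"
      by (simp add: cmod_cinner_ell2_le)
    also have "norm z * norm (g - t) \<le> norm x * \<epsilon>"
    proof (rule mult_mono)
      show "norm (g - t) \<le> \<epsilon>" unfolding t_def using N by (intro less_imp_le[OF F(2)]) auto
    qed (use z(2) in auto)
    finally show ?thesis
      by (simp add: z(3)[symmetric]) (simp add: vector_eval_def cinner_flip_left g_def)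
  qed
  have "cmod (vector_eval B (flip_ell2 x) $ k $ l) \<le> 0"
  proof (rule field_le_epsilon)
    fix e :: real assume "e > 0"
    \<comment> \<open>The divisor \<open>norm x + 1\<close> also covers
      \<open>x = 0\<close>.\<close>
    have "norm x * (e / (norm x + 1)) \<le> e"
      using \<open>e > 0\<close> by (simp add: divide_simps add_nonneg_pos)
    then show "cmod (vector_eval B (flip_ell2 x) $ k $ l) \<le> 0 + e"
      using small[of "e / (norm x + 1)"] \<open>e > 0\<close> by (simp add: add_nonneg_pos)
  qed
  then show "vector_eval B (flip_ell2 x) $ k $ l = 0 $ k $ l" by simp
qed

text \<open>The boundary relators, read as finitely supported vectors, lie in the kernel for
  \<open>A\<close>, hence in that for \<open>B\<close>.\<close>

lemma similar_if_kernel_subset: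
  assumes B: "square_summable_tuple B" and sub: "\<And>x. vector_eval A x = 0 \<Longrightarrow> vector_eval B x = 0"
  shows "similar_tuples A B"
proof (rule similar_if_boundary_relations)
  fix w i
  interpret B: square_summable_tuple B by fact
  let ?M = "eval_word A (w @ [i])"
  have "vector_eval A (basis_ell2 (w @ [i]) - polynomial_vector ?M) = 0"
    by (simp add: vector_eval_diff vector_eval_basis vector_eval_polynomial_vector)
  then have "vector_eval B (basis_ell2 (w @ [i]) - polynomial_vector ?M) = 0" by (rule sub)
  then show "eval_word B (w @ [i]) = (\<Sum>v\<in>S. mat_scale (coord ?M v) (eval_word B v))"
    by (simp add: vector_eval_diff B.vector_eval_basis polynomial_vector_def vector_eval_sum vector_eval_scale)
qed

text \<open>An orthonormal basis of the wandering space of the reversed kernel, reversed back,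
  supplies the vectors \<open>X \<xi>\<close>; thus \<open>Phi B\<close> vanishes on these
  isometries exactly when evaluation at \<open>B\<close> kills that basis.\<close>

lemma isometries_exist:
  defines "m \<equiv> 1 + (CARD('n) - 1) * CARD('d)\<^sup>2"
  shows "\<exists>X :: nat \<Rightarrow> 'n list operator. inj_on X {1..m} \<and>
    (\<forall>j\<in>{1..m}. X j \<in> free_semigroup_algebra \<and> isometry (X j)) \<and>
    (\<forall>B :: ('n, 'd) tuple. row_norm B < 1 \<longrightarrow> (similar_tuples A B \<longleftrightarrow> (\<forall>j\<in>{1..m}. Phi B (X j) = 0)))"
proof -
  obtain E where E: "finite E" "orthonormal_ell2 E" "card E = 1 + (CARD('n) - 1) * CARD('d \<times> 'd)"
    "E \<subseteq> wandering_space right.M"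
    and dec: "\<And>x. x \<in> right.M \<Longrightarrow> \<exists>y. (\<forall>i. y i \<in> right.M) \<and> (\<Sum>i\<in>UNIV. (norm (y i))\<^sup>2) \<le> (norm x)\<^sup>2 \<and>
       x = (\<Sum>e\<in>E. scale_ell2 (cinner_ell2 x e) e) + (\<Sum>i\<in>UNIV. left_creation i (y i))"
    by (rule right.wandering_orthonormal_basis) blast
  have m: "card E = m" by (simp add: E(3) m_def power2_eq_square)
  obtain h where h: "bij_betw h {1..m} E"
    using ex_bij_betw_nat_finite_1[OF E(1)] m by auto
  have "\<exists>X. left_convolution X (flip_ell2 e) \<and> isometry X" if "e \<in> E" for e
  proof -
    have "cinner_ell2 e e = 1" using E(2) that by (simp add: orthonormal_ell2_def)
    then have "(norm e)\<^sup>2 = 1" by (simp add: cinner_ell2_self del: of_real_power)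
    then have "norm e = 1" using norm_ge_zero[of e] by (simp add: power2_eq_1_iff)
    then have "cinner_ell2 (right_word u (flip_ell2 e)) (right_word v (flip_ell2 e)) = (if u = v then 1 else 0)" for u v
      using right.wandering_left_word_orthonormal[of e "rev u" "rev v"] E(4) that
      by (auto simp: right_word_def)
    then show ?thesis using left_convolution_isometry_exists by metis
  qed
  then obtain Y where Y: "\<And>e. e \<in> E \<Longrightarrow> left_convolution (Y e) (flip_ell2 e)" "\<And>e. e \<in> E \<Longrightarrow> isometry (Y e)"
    by metis
  have FSA: "Y e \<in> free_semigroup_algebra" if "e \<in> E" for e
    by (rule left_convolution_in_free_semigroup_algebra[OF Y(1)[OF that]])
  \<comment> \<open>Applying \<open>Y e\<close> to the vacuum and reversing words recovers
    \<open>e\<close>.\<close>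
  have "inj_on Y E"
    by (rule inj_onI) (metis Y(1) left_convolution_vacuum flip_flip_ell2)
  then have "inj_on (Y \<circ> h) {1..m}"
    using h by (intro comp_inj_on) (auto simp: bij_betw_def)
  moreover have "\<forall>j\<in>{1..m}. (Y \<circ> h) j \<in> free_semigroup_algebra \<and> isometry ((Y \<circ> h) j)"
    using h FSA Y(2) by (auto simp: bij_betw_def)
  moreover have "similar_tuples A B \<longleftrightarrow> (\<forall>j\<in>{1..m}. Phi B ((Y \<circ> h) j) = 0)"
    if "row_norm B < 1" for B :: "('n, 'd) tuple"
  proof -
    have B: "square_summable_tuple B" by (rule row_norm_less_1_square_summable[OF that])
    have "Phi B (Y e) = vector_eval B (flip_ell2 e)" if "e \<in> E" for e
      using square_summable_tuple.Phi_eq[OF B FSA[OF that]] left_convolution_vacuum[OF Y(1)[OF that]] by simp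
    then have "(\<forall>j\<in>{1..m}. Phi B ((Y \<circ> h) j) = 0) \<longleftrightarrow> (\<forall>e\<in>E. vector_eval B (flip_ell2 e) = 0)"
      using h by (auto simp: bij_betw_def)
    also have "\<dots> \<longleftrightarrow> similar_tuples A B"
    proof
      assume "\<forall>e\<in>E. vector_eval B (flip_ell2 e) = 0"
      then have "vector_eval B (flip_ell2 x) = 0" if "x \<in> right.M" for x
        using kernel_subset[OF B dec _ that] by blast
      then have "vector_eval B x = 0" if "vector_eval A x = 0" for x
        using that by (metis (mono_tags) flip_flip_ell2 mem_Collect_eq right_M)
      then show "similar_tuples A B" by (rule similar_if_kernel_subset[OF B])
    next
      assume sim: "similar_tuples A B"
      have "vector_eval A (flip_ell2 e) = 0" if "e \<in> E" for e
        using E(4) that by (auto simp: wandering_space_def right_M)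
      then show "\<forall>e\<in>E. vector_eval B (flip_ell2 e) = 0"
        using similar_tuples_vector_eval_eq_0[OF square_summable_tuple_axioms B sim] by blast
    qed
    finally show ?thesis by simp
  qed
  ultimately show ?thesis by blast
qed

end

lemma (in schreier_basis) polynomials_exist:
  defines "m \<equiv> 1 + (CARD('n) - 1) * CARD('d)\<^sup>2"
  shows "\<exists>p :: nat \<Rightarrow> 'n nc_poly. inj_on p {1..m} \<and>
    (\<forall>B. similar_tuples A B \<longleftrightarrow> (\<forall>j\<in>{1..m}. eval_nc_poly (p j) B = 0))"
proof -
  obtain h where h: "bij_betw h {1..m} boundary"
    using ex_bij_betw_nat_finite_1[OF finite_boundary] card_boundary by (auto simp: m_def)
  have "inj_on (relator \<circ> h) {1..m}"
    using h inj_on_relator by (intro comp_inj_on) (auto simp: bij_betw_def)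
  moreover have "similar_tuples A B \<longleftrightarrow> (\<forall>j\<in>{1..m}. eval_nc_poly ((relator \<circ> h) j) B = 0)" for B
    unfolding similar_iff_relators bij_betw_imp_surj_on[OF h, symmetric] by simp
  ultimately show ?thesis by blast
qed

theorem theorem7p8:
  fixes A :: "('n::finite, 'd::finite) tuple"
  assumes "CARD('n) \<ge> 2" and "irreducible_tuple A" and "row_norm A < 1"
  shows "ell2.dim (wandering_space (range_space (ker_Phi A))) = 1 + (CARD('n) - 1) * CARD('d)\<^sup>2 \<and>
    (\<exists>X :: nat \<Rightarrow> 'n list operator.
       inj_on X {1..1 + (CARD('n) - 1) * CARD('d)\<^sup>2} \<and>
       (\<forall>j\<in>{1..1 + (CARD('n) - 1) * CARD('d)\<^sup>2}. X j \<in> free_semigroup_algebra \<and> isometry (X j)) \<and>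
       (\<forall>B :: ('n, 'd) tuple. row_norm B < 1 \<longrightarrow>
          (similar_tuples A B \<longleftrightarrow> (\<forall>j\<in>{1..1 + (CARD('n) - 1) * CARD('d)\<^sup>2}. Phi B (X j) = 0)))) \<and>
    (\<exists>p :: nat \<Rightarrow> 'n nc_poly.
       inj_on p {1..1 + (CARD('n) - 1) * CARD('d)\<^sup>2} \<and>
       (\<forall>B :: ('n, 'd) tuple. row_norm B < 1 \<longrightarrow>
          (similar_tuples A B \<longleftrightarrow> (\<forall>j\<in>{1..1 + (CARD('n) - 1) * CARD('d)\<^sup>2}. eval_nc_poly (p j) B = 0))))"
proof -
  obtain S where "schreier_basis A S" using schreier_basis_exists[OF assms(2)] .
  then interpret square_summable_schreier A S
    using row_norm_less_1_square_summable[OF assms(3)] by (intro square_summable_schreier.intro)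
  \<comment> \<open>The annihilating family is indexed by matrix positions
    \<open>'d \<times> 'd\<close>, whence the square.\<close>
  have "ell2.dim (wandering_space (range_space (ker_Phi A))) = 1 + (CARD('n) - 1) * CARD('d)\<^sup>2"
    unfolding range_space_ker_Phi left.dim_wandering_space by (simp add: power2_eq_square)
  with isometries_exist polynomials_exist show ?thesis by blast
qed

end
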